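(* The Lipschitz experts problem on a metric space $(X,\mathcal{D})$ is either $1$-tractable, even with double feedback, or it is not $g(t)$-tractable for any $g\in o(\sqrt t)$, even with full feedback. The former occurs if and only if the metric completion of $X$ is a compact metric space with countably many points.
   Context: Lipschitz experts problem on a metric space $(X,\mathcal{D})$ (of diameter at most 1, known to the algorithm): an instance is a Borel probability measure $\mathbb{P}$ on $[0,1]^X$ (product topology) such that $\mu(x)=\mathbb{E}_{f\sim\mathbb{P}}[f(x)]$ satisfies $|\mu(x)-\mu(y)|\le\mathcal{D}(x,y)$; $\mathbb{P}$ is unknown. In each round $t$ the algorithm picks $x_t\in X$, a function $f_t$ is drawn independently from $\mathbb{P}$, and the algorithm receives $f_t(x_t)$. Full feedback: the algorithm additionally observes $f_t$ (it may query $f_t$ at any finite number of points). Double feedback: in each round the algorithm picks $x_t$ and one additional point $y_t$, receives $f_t(x_t)$ and observes only $f_t(x_t)$ and $f_t(y_t)$. Regret $R(t)=t\sup_x\mu(x)-\mathbb{E}[\sum_{s\le t}\mu(x_s)]$. The problem is $f(t)$-tractable if there is an algorithm such that for every instance there is a constant $C$ (depending on the instance) with $R(t)\le C f(t)$ for all $t$; $1$-tractable means this with $f\equiv1$. $g\in o(\sqrt t)$ means $g(t)/\sqrt t\to0$. *)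

theory Defs
  imports "HOL-Probability.Probability"
begin

text \<open>
  The metric space X is the type \<open>'a :: metric_space\<close>.  Payoff functions are the points of
  \<open>[0,1]\<^sup>X\<close>; the topology on \<open>'a \<Rightarrow> real\<close> is the product topology, so
  the trace of \<open>borel\<close> is the Borel sigma-algebra of \<open>[0,1]\<^sup>X\<close>.
\<close>

definition payoff_space :: "('a::metric_space \<Rightarrow> real) measure" where
  "payoff_space = restrict_space borel {f. \<forall>x. f x \<in> {0..1}}"

definition mean_payoff :: "('a::metric_space \<Rightarrow> real) measure \<Rightarrow> 'a \<Rightarrow> real" where
  "mean_payoff P x = (\<integral>f. f x \<partial>P)"

definition experts_instance :: "('a::metric_space \<Rightarrow> real) measure \<Rightarrow> bool" where
  "experts_instance P \<longleftrightarrow>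
     prob_space P \<and> sets P = sets payoff_space \<and>
     (\<forall>x y. \<bar>mean_payoff P x - mean_payoff P y\<bar> \<le> dist x y)"

text \<open>
  Adaptive querying of a payoff function: each query may depend on the previous answers.
  The datatype is well-founded, so only finitely many points are queried along every branch,
  although their number need not be bounded.
\<close>

datatype 'a query_tree = Stop | Query 'a "real \<Rightarrow> 'a query_tree"

primrec query_points :: "'a query_tree \<Rightarrow> ('a \<Rightarrow> real) \<Rightarrow> 'a list" where
  "query_points Stop f = []"
| "query_points (Query x k) f = x # query_points (k (f x)) f"

text \<open>
  A strategy maps the random seed and the values observed in the previous rounds (one list per
  round) to the point picked in the current round and the queries made in this round.  The points
  of earlier rounds are determined by these data and hence need not be recorded.
\<close>

type_synonym 'a strategy = "real \<Rightarrow> real list list \<Rightarrow> 'a \<times> 'a query_tree"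

definition round_points :: "'a \<times> 'a query_tree \<Rightarrow> ('a \<Rightarrow> real) \<Rightarrow> 'a list" where
  "round_points a f = fst a # query_points (snd a) f"

text \<open>\<open>F s\<close> is the payoff function of round \<open>s + 1\<close>.\<close>

primrec history ::
  "'a strategy \<Rightarrow> real \<Rightarrow> (nat \<Rightarrow> 'a \<Rightarrow> real) \<Rightarrow> nat \<Rightarrow> real list list" where
  "history \<sigma> \<omega> F 0 = []"
| "history \<sigma> \<omega> F (Suc s) =
     history \<sigma> \<omega> F s @ [map (F s) (round_points (\<sigma> \<omega> (history \<sigma> \<omega> F s)) (F s))]"

definition pick :: "'a strategy \<Rightarrow> real \<Rightarrow> (nat \<Rightarrow> 'a \<Rightarrow> real) \<Rightarrow> nat \<Rightarrow> 'a" where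
  "pick \<sigma> \<omega> F s = fst (\<sigma> \<omega> (history \<sigma> \<omega> F s))"

text \<open>
  The \<open>i\<close>-th point at which the payoff function of a round is evaluated, starting with the picked
  point for \<open>i = 0\<close> and padded with the picked point after the last query.
\<close>

definition evaluated_point ::
  "'a strategy \<Rightarrow> real \<Rightarrow> (nat \<Rightarrow> 'a \<Rightarrow> real) \<Rightarrow> nat \<Rightarrow> nat \<Rightarrow> 'a" where
  "evaluated_point \<sigma> \<omega> F s i =
     (let xs = round_points (\<sigma> \<omega> (history \<sigma> \<omega> F s)) (F s)
      in if i < length xs then xs ! i else pick \<sigma> \<omega> F s)"

text \<open>
  All points used by an algorithm must be random elements of X.  This is imposed on the points as
  functions of the seed and the payoff functions, because on a general X the evaluation map
  sending \<open>(f, x)\<close> to \<open>f x\<close> is not jointly measurable.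
\<close>

definition full_feedback :: "'a::metric_space strategy set" where
  "full_feedback = {\<sigma>. \<forall>s i. (\<lambda>(\<omega>, F). evaluated_point \<sigma> \<omega> F s i)
      \<in> borel \<Otimes>\<^sub>M (\<Pi>\<^sub>M _\<in>(UNIV :: nat set). payoff_space) \<rightarrow>\<^sub>M borel}"

definition double_feedback :: "'a::metric_space strategy set" where
  "double_feedback =
     {\<sigma> \<in> full_feedback. \<forall>\<omega> h. \<exists>y. snd (\<sigma> \<omega> h) = Query y (\<lambda>_. Stop)}"

text \<open>\<open>W\<close> is the distribution of the random seed of the algorithm.\<close>

definition regret ::
  "real measure \<Rightarrow> 'a::metric_space strategy \<Rightarrow> ('a \<Rightarrow> real) measure \<Rightarrow> nat \<Rightarrow> real" where
  "regret W \<sigma> P t =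
     real t * (SUP x. mean_payoff P x)
     - (\<integral>(\<omega>, F). (\<Sum>s<t. mean_payoff P (pick \<sigma> \<omega> F s))
          \<partial>(W \<Otimes>\<^sub>M (\<Pi>\<^sub>M _\<in>(UNIV :: nat set). P)))"

definition tractable :: "'a::metric_space strategy set \<Rightarrow> (nat \<Rightarrow> real) \<Rightarrow> bool" where
  "tractable \<A> g \<longleftrightarrow>
     (\<exists>W. prob_space W \<and> sets W = sets borel \<and>
       (\<exists>\<sigma>\<in>\<A>. \<forall>P. experts_instance P \<longrightarrow>
         (\<exists>C. \<forall>t\<ge>1. regret W \<sigma> P t \<le> C * g t)))"

definition metric_completion :: "'b metric \<Rightarrow> ('a::metric_space \<Rightarrow> 'b) \<Rightarrow> bool" where
  "metric_completion m \<iota> \<longleftrightarrow>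
     mcomplete_of m \<and> range \<iota> \<subseteq> mspace m \<and>
     (\<forall>x y. mdist m (\<iota> x) (\<iota> y) = dist x y) \<and>
     mtopology_of m closure_of range \<iota> = mspace m"

lemma metric_completion_exists:
  "\<exists>(m :: ('a \<Rightarrow> real) metric) (\<iota> :: 'a::metric_space \<Rightarrow> 'a \<Rightarrow> real). metric_completion m \<iota>"
proof (rule Met_TC.metric_completion[where ?'a = 'a])
  fix \<iota> :: "'a \<Rightarrow> 'a \<Rightarrow> real" and m :: "('a \<Rightarrow> real) metric"
  assume "mcomplete_of m" "\<iota> \<in> UNIV \<rightarrow> mspace m"
    "mtopology_of m closure_of range \<iota> = mspace m"
    "\<And>x y. x \<in> UNIV \<Longrightarrow> y \<in> UNIV \<Longrightarrow> mdist m (\<iota> x) (\<iota> y) = dist x y"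
  then have "metric_completion m \<iota>"
    unfolding metric_completion_def by blast
  then show ?thesis
    by blast
qed

end

theory Submission
  imports Defs "HOL-Library.Nat_Bijection" "HOL-Library.Discrete_Functions" "HOL-Real_Asymp.Real_Asymp"
begin

text \<open>
  Lower bound.  If the completion is not compact, \<open>X\<close> contains an infinite uniformly separated set; if it is
  compact but uncountable, it contains a Cantor scheme of separated sets.  Both yield Lipschitz functions
  \<open>\<psi>\<^sub>i : X \<rightarrow> [-1, 1]\<close> realising every finite pattern of signs.  A payoff function is drawn by choosing \<open>i\<close> with
  probability \<open>2\<^sup>-\<^sup>i\<^sup>-\<^sup>1\<close> and a sign \<open>s\<close> with mean \<open>b\<^sub>i \<delta>\<^sub>i\<close>, \<open>b\<^sub>i = \<plusminus>1\<close>, and setting \<open>f = (1 + s \<psi>\<^sub>i) / 2\<close>.  Up to time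
  \<open>N\<^sub>i \<approx> \<delta>\<^sub>i\<^sup>-\<^sup>2\<close> the biases of all levels \<open>j \<ge> i\<close> are statistically invisible by a chi-square bound, so against a
  given algorithm \<open>b\<^sub>i\<close> can be chosen adversarially from its behaviour under the instance that is unbiased from
  level \<open>i\<close> on, which costs it regret of order \<open>2\<^sup>-\<^sup>i \<surd>N\<^sub>i\<close> at time \<open>N\<^sub>i\<close>.  As \<open>N\<^sub>i\<close> may grow arbitrarily fast,
  this beats \<open>C g(N\<^sub>i)\<close>.

  Upper bound.  Exploration is free, so the means of the points of the countable completion \<open>K\<close> can be estimated
  along a fixed schedule of queries.  The algorithm plays, among the points whose estimates are within the
  confidence width of the best one, a point of highest rank with respect to a chain of open sets in which each
  point is isolated in the complement of its lower part (\<open>K\<close> is scattered).  Among the maximisers of the mean there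
  is one of highest rank by compactness; the points of at least this rank which are not optimal form a closed set,
  on which the mean has a positive gap.  Hence once the estimates are accurate the played point is optimal, and by
  Hoeffding's inequality the probabilities of inaccurate estimates are summable.
\<close>

section \<open>Tilted distributions\<close>

lemma integrable_bounded_pmf:
  fixes f :: "'z \<Rightarrow> real"
  assumes "\<And>x. \<bar>f x\<bar> \<le> B"
  shows "integrable (measure_pmf p) f"
  using assms by (intro measure_pmf.integrable_const_bound[where B = B]) auto

lemma expectation_bind_pmf_bounded:
  fixes f :: "'z \<Rightarrow> real"
  assumes B: "\<And>x. \<bar>f x\<bar> \<le> B"
  shows "measure_pmf.expectation (bind_pmf p N) f
       = measure_pmf.expectation p (\<lambda>x. measure_pmf.expectation (N x) f)"
  unfolding measure_pmf_bind
  by (rule integral_bind[where K = "count_space UNIV" and B' = 1 and B = B])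
     (use B in \<open>auto simp: measure_pmf.emeasure_space_1 measure_pmf_in_subprob_space\<close>)

lemma expectation_replicate_pmf_Suc:
  fixes f :: "'z list \<Rightarrow> real"
  assumes "\<And>x. \<bar>f x\<bar> \<le> B"
  shows "measure_pmf.expectation (replicate_pmf (Suc n) p) f
       = measure_pmf.expectation p (\<lambda>x. measure_pmf.expectation (replicate_pmf n p) (\<lambda>xs. f (x # xs)))"
  using assms by (simp add: expectation_bind_pmf_bounded[where B = B])

lemma expectation_bounded_pmf:
  fixes f :: "'z \<Rightarrow> real"
  assumes "\<And>x. \<bar>f x\<bar> \<le> B"
  shows "\<bar>measure_pmf.expectation p f\<bar> \<le> B"
proof -
  have i: "integrable (measure_pmf p) f"
    using assms by (rule integrable_bounded_pmf)
  have "\<bar>measure_pmf.expectation p f\<bar> \<le> measure_pmf.expectation p (\<lambda>x. \<bar>f x\<bar>)"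
    by (rule integral_abs_bound)
  also have "\<dots> \<le> measure_pmf.expectation p (\<lambda>x. B)"
    by (intro integral_mono) (use i assms in auto)
  finally show ?thesis
    by simp
qed

lemma abs_prod_list_bounded:
  fixes l :: "'z \<Rightarrow> real"
  assumes "\<And>x. \<bar>l x\<bar> \<le> B" "B \<ge> 1" "length zs \<le> t"
  shows "\<bar>prod_list (map l zs)\<bar> \<le> B ^ t"
  using assms(3)
proof (induction zs arbitrary: t)
  case Nil
  then show ?case
    using assms(2) by simp
next
  case (Cons z zs)
  then obtain t' where t: "t = Suc t'" "length zs \<le> t'"
    by (cases t) auto
  have "\<bar>l z\<bar> * \<bar>prod_list (map l zs)\<bar> \<le> B * B ^ t'"
    using Cons.IH[OF t(2)] assms(1)[of z] assms(2) by (intro mult_mono) auto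
  then show ?case
    by (simp add: t abs_mult)
qed

text \<open>\<open>l\<close> is the density of \<open>q\<close> with respect to \<open>p\<close>,
  expressed through bounded test functions. The bound 2 is what the densities
  \<open>1 + \<beta>' j\<close> and \<open>1 - \<beta>' j\<close> of biased signs satisfy.\<close>

locale tilted_pmf =
  fixes p q :: "'z pmf" and l :: "'z \<Rightarrow> real"
  assumes tilt: "\<And>h B. (\<And>z. \<bar>h z\<bar> \<le> B) \<Longrightarrow>
      measure_pmf.expectation q h = measure_pmf.expectation p (\<lambda>z. h z * l z)"
    and l_bounded: "\<And>z. \<bar>l z\<bar> \<le> 2"
begin

text \<open>Setting the likelihood ratio to 0 on longer lists makes it bounded everywhere.\<close>

definition ratio :: "nat \<Rightarrow> 'z list \<Rightarrow> real" where
  "ratio t zs = (if length zs \<le> t then prod_list (map l zs) else 0)"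

lemma ratio_bounded: "\<bar>ratio t zs\<bar> \<le> 2 ^ t"
  using abs_prod_list_bounded[of l 2 zs t] l_bounded by (simp add: ratio_def)

lemma ratio_Cons: "ratio (Suc t) (z # zs) = l z * ratio t zs"
  by (simp add: ratio_def)

lemma mult_ratio_bounded: "\<bar>h zs\<bar> \<le> B \<Longrightarrow> \<bar>h zs * ratio t zs\<bar> \<le> B * 2 ^ t"
  using ratio_bounded[of t zs] by (auto simp: abs_mult intro!: mult_mono)

text \<open>The likelihood ratio of independent samples is the product of the single ratios. The
  induction splits off the first sample and absorbs its factor with \<open>tilt\<close>;
  \<open>h\<close> is generalised because fixing that sample changes the test function.\<close>

lemma expectation_replicate_tilt:
  assumes "\<And>zs. \<bar>h zs\<bar> \<le> B"
  shows "measure_pmf.expectation (replicate_pmf t q) h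
       = measure_pmf.expectation (replicate_pmf t p) (\<lambda>zs. h zs * ratio t zs)"
  using assms
proof (induction t arbitrary: h)
  case 0
  then show ?case
    by (simp add: ratio_def)
next
  case (Suc t)
  have "measure_pmf.expectation (replicate_pmf (Suc t) q) h
      = measure_pmf.expectation q (\<lambda>x. measure_pmf.expectation (replicate_pmf t p) (\<lambda>xs. h (x # xs) * ratio t xs))"
    using Suc.prems by (simp only: expectation_replicate_pmf_Suc[where B = B] Suc.IH)
  also have "\<dots> = measure_pmf.expectation p
      (\<lambda>x. measure_pmf.expectation (replicate_pmf t p) (\<lambda>xs. h (x # xs) * ratio t xs) * l x)"
    by (rule tilt[where B = "B * 2 ^ t"])
       (intro expectation_bounded_pmf mult_ratio_bounded Suc.prems)
  also have "\<dots> = measure_pmf.expectation p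
      (\<lambda>x. measure_pmf.expectation (replicate_pmf t p) (\<lambda>xs. h (x # xs) * ratio (Suc t) (x # xs)))"
    by (simp add: ratio_Cons mult.assoc mult.left_commute flip: integral_mult_left_zero)
       (simp add: mult_ac)
  also have "\<dots> = measure_pmf.expectation (replicate_pmf (Suc t) p) (\<lambda>zs. h zs * ratio (Suc t) zs)"
    by (rule expectation_replicate_pmf_Suc[symmetric, where B = "B * 2 ^ Suc t"])
       (intro mult_ratio_bounded Suc.prems)
  finally show ?case .
qed

lemma expectation_ratio: "measure_pmf.expectation (replicate_pmf t p) (ratio t) = 1"
  using expectation_replicate_tilt[of "\<lambda>_. 1" 1 t] by simp

lemma ratio_sq_bounded: "\<bar>(ratio t zs)\<^sup>2\<bar> \<le> (2 ^ t)\<^sup>2"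
  by (metis abs_ge_zero abs_power2 power2_abs power_mono ratio_bounded)

text \<open>Independence makes the second moment multiplicative. As the ratio has mean 1, this
  computes its variance, the chi-square divergence of the two product laws.\<close>

lemma expectation_ratio_sq:
  "measure_pmf.expectation (replicate_pmf t p) (\<lambda>zs. (ratio t zs)\<^sup>2)
     = measure_pmf.expectation p (\<lambda>z. (l z)\<^sup>2) ^ t"
proof (induction t)
  case 0
  then show ?case
    by (simp add: ratio_def)
next
  case (Suc t)
  have "measure_pmf.expectation (replicate_pmf (Suc t) p) (\<lambda>zs. (ratio (Suc t) zs)\<^sup>2)
      = measure_pmf.expectation p (\<lambda>x. measure_pmf.expectation (replicate_pmf t p)
          (\<lambda>xs. (ratio (Suc t) (x # xs))\<^sup>2))"
    by (rule expectation_replicate_pmf_Suc) (rule ratio_sq_bounded)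
  then show ?case
    by (simp add: ratio_Cons power_mult_distrib Suc.IH)
qed

text \<open>The difference of the expectations is that of \<open>h\<close> times
  \<open>ratio - 1\<close>, and \<open>ratio\<close> has variance at most 1/16. The bound
  \<open>\<bar>x\<bar> \<le> 2 * x\<^sup>2 + 1 / 8\<close> then gives 2/16 + 1/8 = 1/4.\<close>

lemma expectation_replicate_close:
  fixes h :: "'z list \<Rightarrow> real"
  assumes h: "\<And>zs. 0 \<le> h zs" "\<And>zs. h zs \<le> 1"
    and chi2: "measure_pmf.expectation p (\<lambda>z. (l z)\<^sup>2) ^ t \<le> 1 + 1 / 16"
  shows "\<bar>measure_pmf.expectation (replicate_pmf t q) h - measure_pmf.expectation (replicate_pmf t p) h\<bar> \<le> 1 / 4"
proof -
  let ?E = "measure_pmf.expectation (replicate_pmf t p)"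
  have hb: "\<bar>h zs\<bar> \<le> 1" for zs
    using h[of zs] by auto
  have i1: "integrable (replicate_pmf t p) (\<lambda>zs. h zs * ratio t zs)"
    using mult_ratio_bounded[OF hb] by (rule integrable_bounded_pmf)
  have i2: "integrable (replicate_pmf t p) h"
    using hb by (rule integrable_bounded_pmf)
  have i3: "integrable (replicate_pmf t p) (\<lambda>zs. (ratio t zs)\<^sup>2)"
    by (rule integrable_bounded_pmf, rule ratio_sq_bounded)
  have i4: "integrable (replicate_pmf t p) (ratio t)"
    by (rule integrable_bounded_pmf, rule ratio_bounded)
  have eq: "(ratio t zs - 1)\<^sup>2 = (ratio t zs)\<^sup>2 - 2 * ratio t zs + 1" for zs
    by (simp add: power2_eq_square algebra_simps)
  have "?E (\<lambda>zs. (ratio t zs - 1)\<^sup>2) = ?E (\<lambda>zs. (ratio t zs)\<^sup>2) - 2 * ?E (ratio t) + 1"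
    unfolding eq using i3 i4 by simp
  then have var: "?E (\<lambda>zs. (ratio t zs - 1)\<^sup>2) \<le> 1 / 16"
    using chi2 by (simp add: expectation_ratio_sq expectation_ratio)
  have i5: "integrable (replicate_pmf t p) (\<lambda>zs. (ratio t zs - 1)\<^sup>2)"
    unfolding eq using i3 i4 by simp
  \<comment> \<open>AM-GM in place of Cauchy-Schwarz\<close>
  have amgm: "\<bar>x\<bar> \<le> 2 * x\<^sup>2 + 1 / 8" for x :: real
    using zero_le_power2[of "4 * \<bar>x\<bar> - 1"] by (simp add: power2_eq_square algebra_simps)
  have "\<bar>measure_pmf.expectation (replicate_pmf t q) h - ?E h\<bar> = \<bar>?E (\<lambda>zs. h zs * ratio t zs - h zs)\<bar>"
    by (subst expectation_replicate_tilt[OF hb]) (simp add: i1 i2)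
  also have "\<dots> \<le> ?E (\<lambda>zs. \<bar>h zs * ratio t zs - h zs\<bar>)"
    by (rule integral_abs_bound)
  also have "\<dots> \<le> ?E (\<lambda>zs. 2 * (ratio t zs - 1)\<^sup>2 + 1 / 8)"
  proof (rule integral_mono)
    show "integrable (replicate_pmf t p) (\<lambda>zs. \<bar>h zs * ratio t zs - h zs\<bar>)"
      using i1 i2 by auto
    show "integrable (replicate_pmf t p) (\<lambda>zs. 2 * (ratio t zs - 1)\<^sup>2 + 1 / 8)"
      using i5 by auto
    fix zs
    have "\<bar>h zs * ratio t zs - h zs\<bar> = h zs * \<bar>ratio t zs - 1\<bar>"
      by (metis abs_mult abs_of_nonneg h(1) mult.right_neutral right_diff_distrib)
    also have "\<dots> \<le> \<bar>ratio t zs - 1\<bar>"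
      using h[of zs] by (simp add: mult_left_le_one_le)
    also have "\<dots> \<le> 2 * (ratio t zs - 1)\<^sup>2 + 1 / 8"
      by (rule amgm)
    finally show "\<bar>h zs * ratio t zs - h zs\<bar> \<le> 2 * (ratio t zs - 1)\<^sup>2 + 1 / 8" .
  qed
  also have "\<dots> = 2 * ?E (\<lambda>zs. (ratio t zs - 1)\<^sup>2) + 1 / 8"
    using i5 by simp
  finally show ?thesis
    using var by simp
qed

end

section \<open>Lower bound\<close>

lemma space_payoff_space: "space payoff_space = {f. \<forall>x. f x \<in> {0..1}}"
  by (simp add: payoff_space_def space_restrict_space)

text \<open>Turns an integral over infinitely many rounds into one over a list of \<open>t\<close>
  discrete samples, where the chi-square bound applies. The product measure is the law of an
  independent head and tail glued by \<open>case_nat\<close>, so Fubini peels off one round at a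
  time; \<open>f0\<close> fills the rounds on which \<open>h\<close> does not depend.\<close>

lemma expectation_PiM_unroll:
  fixes h :: "(nat \<Rightarrow> 'a::metric_space \<Rightarrow> real) \<Rightarrow> real"
  assumes \<Phi>: "\<And>z. \<Phi> z \<in> space payoff_space"
    and f0: "f0 \<in> space payoff_space"
    and h: "h \<in> borel_measurable (\<Pi>\<^sub>M _\<in>(UNIV :: nat set). payoff_space)"
    and B: "\<And>F. \<bar>h F\<bar> \<le> B"
    and dep: "\<And>F G. (\<And>s. s < t \<Longrightarrow> F s = G s) \<Longrightarrow> h F = h G"
  shows "(\<integral>F. h F \<partial>(\<Pi>\<^sub>M _\<in>(UNIV :: nat set). distr (measure_pmf p) payoff_space \<Phi>))
       = measure_pmf.expectation (replicate_pmf t p) (\<lambda>zs. h (\<lambda>s. if s < t then \<Phi> (zs ! s) else f0))"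
  using h B dep
proof (induction t arbitrary: h)
  case 0
  interpret P: prob_space "distr (measure_pmf p) payoff_space \<Phi>"
    using \<Phi> by (intro measure_pmf.prob_space_distr) auto
  have S: "prob_space (\<Pi>\<^sub>M _\<in>(UNIV :: nat set). distr (measure_pmf p) payoff_space \<Phi>)"
    by (intro prob_space_PiM P.prob_space_axioms)
  obtain c where "h = (\<lambda>_. c)"
    using "0.prems"(3) by (metis (mono_tags) less_nat_zero_code ext)
  then show ?case
    using prob_space.prob_space[OF S] by simp
next
  case (Suc t)
  let ?P = "distr (measure_pmf p) payoff_space \<Phi>"
  interpret P: prob_space ?P
    using \<Phi> by (intro measure_pmf.prob_space_distr) auto
  interpret S: sequence_space ?P ..
  have sf: "sigma_finite_measure S.S"
    by (intro prob_space_imp_sigma_finite prob_space_PiM P.prob_space_axioms)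
  have sets_S: "sets S.S = sets (\<Pi>\<^sub>M _\<in>(UNIV :: nat set). payoff_space)"
    by (intro sets_PiM_cong) auto
  have [measurable]: "h \<in> borel_measurable S.S"
    using Suc.prems(1) by (simp cong: measurable_cong_sets add: sets_S)
  have [measurable]: "\<Phi> \<in> measure_pmf p \<rightarrow>\<^sub>M payoff_space"
    using \<Phi> by auto
  interpret PS: pair_prob_space ?P S.S ..
  have cn: "(\<lambda>(s, \<omega>). case_nat s \<omega>) \<in> ?P \<Otimes>\<^sub>M S.S \<rightarrow>\<^sub>M S.S"
    by measurable
  have m2: "(\<lambda>x. h (case x of (s, \<omega>) \<Rightarrow> case_nat s \<omega>)) \<in> borel_measurable (?P \<Otimes>\<^sub>M S.S)"
    using measurable_comp[OF cn, of h borel] by (simp add: comp_def)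
  have "(\<integral>F. h F \<partial>S.S) = (\<integral>F. h F \<partial>distr (?P \<Otimes>\<^sub>M S.S) S.S (\<lambda>(s, \<omega>). case_nat s \<omega>))"
    by (simp add: S.PiM_iter)
  also have "\<dots> = (\<integral>x. h (case x of (s, \<omega>) \<Rightarrow> case_nat s \<omega>) \<partial>(?P \<Otimes>\<^sub>M S.S))"
    by (rule integral_distr) (use cn in auto)
  also have "\<dots> = (\<integral>f. \<integral>F. h (case_nat f F) \<partial>S.S \<partial>?P)"
  proof -
    have "integrable (?P \<Otimes>\<^sub>M S.S) (\<lambda>x. h (case x of (s, \<omega>) \<Rightarrow> case_nat s \<omega>))"
      by (rule PS.integrable_const_bound[where B = B]) (use Suc.prems(2) m2 in auto)
    from PS.integral_fst'[OF this] show ?thesis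
      by simp
  qed
  also have "\<dots> = measure_pmf.expectation p (\<lambda>z. \<integral>F. h (case_nat (\<Phi> z) F) \<partial>S.S)"
  proof (rule integral_distr)
    have "(\<lambda>f. \<integral>F. h (case_nat f F) \<partial>S.S) \<in> borel_measurable ?P"
      using sigma_finite_measure.borel_measurable_lebesgue_integral[OF sf, of "\<lambda>f F. h (case_nat f F)" ?P] m2
      by (simp add: split_beta')
    then show "(\<lambda>f. \<integral>F. h (case_nat f F) \<partial>S.S) \<in> borel_measurable payoff_space"
      by simp
  qed (use \<Phi> in auto)
  also have "\<dots> = measure_pmf.expectation p (\<lambda>z. measure_pmf.expectation (replicate_pmf t p)
        (\<lambda>zs. h (case_nat (\<Phi> z) (\<lambda>s. if s < t then \<Phi> (zs ! s) else f0))))"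
  proof (rule Bochner_Integration.integral_cong[OF refl])
    fix z
    have "(\<lambda>F. h (case_nat (\<Phi> z) F)) \<in> borel_measurable S.S"
    proof -
      have "(\<lambda>F. case_nat (\<Phi> z) F) \<in> S.S \<rightarrow>\<^sub>M S.S"
        using \<Phi>[of z] by (intro measurable_case_nat'[where f = "\<lambda>_. \<Phi> z"]) auto
      from measurable_comp[OF this, of h borel] show ?thesis
        by (simp add: comp_def)
    qed
    then show "(\<integral>F. h (case_nat (\<Phi> z) F) \<partial>S.S) = measure_pmf.expectation (replicate_pmf t p)
        (\<lambda>zs. h (case_nat (\<Phi> z) (\<lambda>s. if s < t then \<Phi> (zs ! s) else f0)))"
      by (intro Suc.IH Suc.prems)
         (auto simp: sets_S less_Suc_eq_0_disj intro!: Suc.prems cong: measurable_cong_sets split: nat.split)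
  qed
  also have "\<dots> = measure_pmf.expectation p (\<lambda>z. measure_pmf.expectation (replicate_pmf t p)
        (\<lambda>zs. h (\<lambda>s. if s < Suc t then \<Phi> ((z # zs) ! s) else f0)))"
  proof -
    have "case_nat (\<Phi> z) (\<lambda>s. if s < t then \<Phi> (zs ! s) else f0)
        = (\<lambda>s. if s < Suc t then \<Phi> ((z # zs) ! s) else f0)" for z zs
      by (auto split: nat.split)
    then show ?thesis
      by simp
  qed
  also have "\<dots> = measure_pmf.expectation (replicate_pmf (Suc t) p)
      (\<lambda>zs. h (\<lambda>s. if s < Suc t then \<Phi> (zs ! s) else f0))"
    by (rule expectation_replicate_pmf_Suc[symmetric]) (rule Suc.prems)
  finally show ?case .
qed

section \<open>Payoff functions with a random level and a biased sign\<close>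

lemma expectation_indicator_pmf:
  "measure_pmf.expectation p (indicator {i}) = pmf p i"
  by (simp add: pmf.rep_eq)

text \<open>Level \<open>i\<close> has probability \<open>(1/2) ^ (i + 1)\<close>, and
  \<open>\<beta> i\<close> is the conditional mean of the sign read as +1 or -1.\<close>

definition signed_coin :: "(nat \<Rightarrow> real) \<Rightarrow> (nat \<times> bool) pmf" where
  "signed_coin \<beta> = do {i \<leftarrow> geometric_pmf (1/2); s \<leftarrow> bernoulli_pmf ((1 + \<beta> i) / 2); return_pmf (i, s)}"

lemma expectation_signed_coin:
  fixes h :: "nat \<times> bool \<Rightarrow> real"
  assumes \<beta>: "\<And>i. \<bar>\<beta> i\<bar> \<le> 1" and h: "\<And>z. \<bar>h z\<bar> \<le> B"
  shows "measure_pmf.expectation (signed_coin \<beta>) h = measure_pmf.expectation (geometric_pmf (1/2))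
     (\<lambda>i. (1 + \<beta> i) / 2 * h (i, True) + (1 - \<beta> i) / 2 * h (i, False))"
proof -
  have "0 \<le> (1 + \<beta> i) / 2 \<and> (1 + \<beta> i) / 2 \<le> 1" for i
    using \<beta>[of i] by auto
  then show ?thesis
    unfolding signed_coin_def
    by (simp add: expectation_bind_pmf_bounded[OF h] field_simps)
qed

text \<open>The two laws differ only at levels where \<open>\<beta>\<close> is unbiased. There each
  sign has conditional probability 1/2 under \<open>\<beta>\<close>, so the density is twice its
  probability under \<open>\<beta>'\<close>.\<close>

lemma tilted_signed_coin:
  assumes \<beta>: "\<And>j. \<bar>\<beta> j\<bar> \<le> 1" and \<beta>': "\<And>j. \<bar>\<beta>' j\<bar> \<le> 1"
    and eq: "\<And>j. \<beta> j = \<beta>' j \<or> \<beta> j = 0"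
  shows "tilted_pmf (signed_coin \<beta>) (signed_coin \<beta>')
     (\<lambda>(j, s). if \<beta> j = \<beta>' j then 1 else if s then 1 + \<beta>' j else 1 - \<beta>' j)"
proof
  let ?l = "\<lambda>(j, s). if \<beta> j = \<beta>' j then 1 else if s then 1 + \<beta>' j else 1 - \<beta>' j"
  show l2: "\<bar>?l z\<bar> \<le> 2" for z
    using \<beta>'[of "fst z"] by (auto simp: split_beta)
  fix h :: "nat \<times> bool \<Rightarrow> real" and B
  assume h: "\<And>z. \<bar>h z\<bar> \<le> B"
  have "\<bar>h z * ?l z\<bar> \<le> B * 2" for z
    using h[of z] l2[of z] unfolding abs_mult by (intro mult_mono) auto
  then show "measure_pmf.expectation (signed_coin \<beta>') h
      = measure_pmf.expectation (signed_coin \<beta>) (\<lambda>z. h z * ?l z)"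
    apply (subst expectation_signed_coin[OF \<beta>' h])
    apply (subst expectation_signed_coin[OF \<beta>, where B = "B * 2"])
     apply assumption
    apply (rule Bochner_Integration.integral_cong[OF refl])
    subgoal for j using eq[of j] by (auto simp: mult_ac)
    done
qed

text \<open>At a changed level both signs are equally likely, and the average of
  \<open>(1 + \<beta>' j)\<^sup>2\<close> and \<open>(1 - \<beta>' j)\<^sup>2\<close> is
  \<open>1 + (\<beta>' j)\<^sup>2\<close>; the linear terms cancel. All other levels contribute
  1.\<close>

lemma expectation_signed_coin_tilt_sq:
  assumes \<beta>: "\<And>j. \<bar>\<beta> j\<bar> \<le> 1" and \<beta>': "\<And>j. \<bar>\<beta>' j\<bar> \<le> 1"
    and eq: "\<And>j. \<beta> j = \<beta>' j \<or> \<beta> j = 0 \<and> \<bar>\<beta>' j\<bar> \<le> \<delta>"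
  shows "measure_pmf.expectation (signed_coin \<beta>)
     (\<lambda>z. (case z of (j, s) \<Rightarrow> if \<beta> j = \<beta>' j then 1 else if s then 1 + \<beta>' j else 1 - \<beta>' j)\<^sup>2) \<le> 1 + \<delta>\<^sup>2"
proof -
  let ?l = "\<lambda>(j, s). if \<beta> j = \<beta>' j then 1 else if s then 1 + \<beta>' j else 1 - \<beta>' j"
  let ?E = "measure_pmf.expectation (signed_coin \<beta>)"
  have l2: "\<bar>?l z\<bar> \<le> 2" for z
    using \<beta>'[of "fst z"] by (auto simp: split_beta)
  have "\<bar>(?l z)\<^sup>2\<bar> \<le> 2\<^sup>2" for z
    using power_mono[OF l2[of z], of 2] by simp
  then have "?E (\<lambda>z. (?l z)\<^sup>2) = measure_pmf.expectation (geometric_pmf (1/2))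
      (\<lambda>j. (1 + \<beta> j) / 2 * (?l (j, True))\<^sup>2 + (1 - \<beta> j) / 2 * (?l (j, False))\<^sup>2)"
    by (rule expectation_signed_coin[OF \<beta>])
  also have "\<dots> = measure_pmf.expectation (geometric_pmf (1/2)) (\<lambda>j. if \<beta> j = \<beta>' j then 1 else 1 + (\<beta>' j)\<^sup>2)"
  proof (rule Bochner_Integration.integral_cong[OF refl])
    fix j
    show "(1 + \<beta> j) / 2 * (?l (j, True))\<^sup>2 + (1 - \<beta> j) / 2 * (?l (j, False))\<^sup>2
        = (if \<beta> j = \<beta>' j then 1 else 1 + (\<beta>' j)\<^sup>2)"
      using eq[of j] by (auto simp: power2_eq_square field_simps)
  qed
  also have "\<dots> \<le> 1 + \<delta>\<^sup>2"
  proof -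
    have "(if \<beta> j = \<beta>' j then 1 else 1 + (\<beta>' j)\<^sup>2) \<le> 1 + \<delta>\<^sup>2" for j
      using eq[of j] abs_le_square_iff[of "\<beta>' j" \<delta>] by auto
    moreover have "0 \<le> (if \<beta> j = \<beta>' j then 1 else 1 + (\<beta>' j)\<^sup>2)" for j
      by auto
    ultimately have "\<bar>if \<beta> j = \<beta>' j then 1 else 1 + (\<beta>' j)\<^sup>2\<bar> \<le> 1 + \<delta>\<^sup>2" for j
      by (simp only: abs_of_nonneg)
    from expectation_bounded_pmf[OF this] show ?thesis
      by fastforce
  qed
  finally show ?thesis .
qed

lemma history_cong:
  "(\<And>r. r < s \<Longrightarrow> F r = G r) \<Longrightarrow> history \<sigma> \<omega> F s = history \<sigma> \<omega> G s"
  by (induction s) auto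

lemma pick_cong:
  "(\<And>r. r < s \<Longrightarrow> F r = G r) \<Longrightarrow> pick \<sigma> \<omega> F s = pick \<sigma> \<omega> G s"
  unfolding pick_def by (metis history_cong)

text \<open>The picked point is the evaluated point of index 0.\<close>

lemma pick_measurable:
  assumes "\<sigma> \<in> full_feedback"
  shows "(\<lambda>(\<omega>, F). pick \<sigma> \<omega> F s) \<in> borel \<Otimes>\<^sub>M (\<Pi>\<^sub>M _\<in>(UNIV :: nat set). payoff_space) \<rightarrow>\<^sub>M borel"
proof -
  have "evaluated_point \<sigma> \<omega> F s 0 = pick \<sigma> \<omega> F s" for \<omega> F
    by (simp add: evaluated_point_def round_points_def pick_def)
  then show ?thesis
    using assms unfolding full_feedback_def by simp (erule allE[where x = s], erule allE[where x = 0], simp)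
qed

definition signed_payoff :: "(nat \<Rightarrow> 'a \<Rightarrow> real) \<Rightarrow> nat \<times> bool \<Rightarrow> 'a \<Rightarrow> real" where
  "signed_payoff \<psi> = (\<lambda>(i, s) x. (1 + (if s then \<psi> i x else - \<psi> i x)) / 2)"

definition signed_instance :: "(nat \<Rightarrow> 'a::metric_space \<Rightarrow> real) \<Rightarrow> (nat \<Rightarrow> real) \<Rightarrow> ('a \<Rightarrow> real) measure" where
  "signed_instance \<psi> \<beta> = distr (signed_coin \<beta>) payoff_space (signed_payoff \<psi>)"

lemma sets_signed_instance: "sets (signed_instance \<psi> \<beta>) = sets payoff_space"
  by (simp add: signed_instance_def)

lemma eval_measurable_payoff_space [measurable]: "(\<lambda>f. f x) \<in> borel_measurable payoff_space"
  unfolding payoff_space_def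
  by (rule measurable_restrict_space1) (intro borel_measurable_continuous_onI continuous_on_product_coordinates)

lemma mult_le_one_abs:
  fixes a b :: real
  shows "\<bar>a\<bar> \<le> 1 \<Longrightarrow> \<bar>b\<bar> \<le> 1 \<Longrightarrow> \<bar>a * b\<bar> \<le> 1"
  by (simp add: abs_mult mult_le_one)

text \<open>Only finite sign patterns are required to be realised, so the supremum of the mean is in
  general approached rather than attained. The constants \<open>Lip i\<close> may grow freely, since
  the biases can be taken small enough to compensate.\<close>

locale sign_functions =
  fixes \<psi> :: "nat \<Rightarrow> 'a::metric_space \<Rightarrow> real" and Lip :: "nat \<Rightarrow> real"
  assumes \<psi>_bounded: "\<And>i x. \<bar>\<psi> i x\<bar> \<le> 1"
    and \<psi>_Lipschitz: "\<And>i x y. \<bar>\<psi> i x - \<psi> i y\<bar> \<le> Lip i * dist x y"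
    and \<psi>_pattern: "\<And>b n. (\<And>i. b i = 1 \<or> b i = -1) \<Longrightarrow> \<exists>x. \<forall>i<n. \<psi> i x = b i"
begin

lemma signed_payoff_in_space: "signed_payoff \<psi> z \<in> space payoff_space"
  unfolding space_payoff_space signed_payoff_def
proof (cases z, clarify)
  fix i s and x :: 'a
  show "(1 + (if s then \<psi> i x else - \<psi> i x)) / 2 \<in> {0..1}"
    using \<psi>_bounded[of i x] by (auto simp: abs_le_iff)
qed

lemma prob_space_signed_instance: "prob_space (signed_instance \<psi> \<beta>)"
  unfolding signed_instance_def using signed_payoff_in_space
  by (intro measure_pmf.prob_space_distr) auto

lemma mean_payoff_signed_instance:
  assumes \<beta>: "\<And>i. \<bar>\<beta> i\<bar> \<le> 1"
  shows "mean_payoff (signed_instance \<psi> \<beta>) x = measure_pmf.expectation (geometric_pmf (1/2)) (\<lambda>i. (1 + \<beta> i * \<psi> i x) / 2)"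
proof -
  have "\<bar>signed_payoff \<psi> z x\<bar> \<le> 1" for z
    using signed_payoff_in_space[of z] by (auto simp: space_payoff_space dest: spec[of _ x])
  then have "measure_pmf.expectation (signed_coin \<beta>) (\<lambda>z. signed_payoff \<psi> z x)
     = measure_pmf.expectation (geometric_pmf (1/2)) (\<lambda>i. (1 + \<beta> i) / 2 * signed_payoff \<psi> (i, True) x
        + (1 - \<beta> i) / 2 * signed_payoff \<psi> (i, False) x)"
    by (rule expectation_signed_coin[OF \<beta>])
  also have "\<dots> = measure_pmf.expectation (geometric_pmf (1/2)) (\<lambda>i. (1 + \<beta> i * \<psi> i x) / 2)"
    by (intro Bochner_Integration.integral_cong refl) (simp add: signed_payoff_def field_simps)
  finally show ?thesis
    unfolding mean_payoff_def signed_instance_def using signed_payoff_in_space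
    by (subst integral_distr) auto
qed

lemma integrable_mean:
  assumes \<beta>: "\<And>i. \<bar>\<beta> i\<bar> \<le> 1"
  shows "integrable (measure_pmf p) (\<lambda>i. (1 + \<beta> i * \<psi> i x) / 2)"
proof (rule integrable_bounded_pmf[where B = 1])
  fix i
  show "\<bar>(1 + \<beta> i * \<psi> i x) / 2\<bar> \<le> 1"
    using mult_le_one_abs[OF \<beta>[of i] \<psi>_bounded[of i x]] by (simp add: abs_le_iff)
qed

text \<open>Level \<open>i\<close> contributes to the mean a function with Lipschitz constant
  \<open>\<bar>\<beta> i\<bar> * Lip i / 2\<close>, and averaging over the levels preserves a common
  Lipschitz bound.\<close>

lemma experts_instance_signed_instance:
  assumes \<beta>: "\<And>i. \<bar>\<beta> i\<bar> \<le> 1" and \<beta>L: "\<And>i. \<bar>\<beta> i\<bar> * Lip i \<le> 1"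
  shows "experts_instance (signed_instance \<psi> \<beta>)"
  unfolding experts_instance_def
proof (intro conjI allI)
  fix x y
  have "\<bar>(1 + \<beta> i * \<psi> i x) / 2 - (1 + \<beta> i * \<psi> i y) / 2\<bar> \<le> dist x y" for i
  proof -
    have "\<bar>(1 + \<beta> i * \<psi> i x) / 2 - (1 + \<beta> i * \<psi> i y) / 2\<bar> = \<bar>\<beta> i * (\<psi> i x - \<psi> i y) / 2\<bar>"
      by (rule arg_cong[where f = abs]) (simp add: field_simps)
    also have "\<dots> = \<bar>\<beta> i * (\<psi> i x - \<psi> i y)\<bar> / 2"
      by simp
    also have "\<dots> \<le> \<bar>\<beta> i\<bar> * (Lip i * dist x y) / 2"
      using mult_left_mono[OF \<psi>_Lipschitz[of i x y], of "\<bar>\<beta> i\<bar>"] by (simp add: abs_mult)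
    also have "\<dots> \<le> 1 * dist x y / 2"
      using mult_right_mono[OF \<beta>L[of i], of "dist x y"] by (simp add: mult.assoc)
    also have "\<dots> \<le> dist x y"
      by simp
    finally show ?thesis .
  qed
  then have "\<bar>measure_pmf.expectation (geometric_pmf (1/2))
      (\<lambda>i. (1 + \<beta> i * \<psi> i x) / 2 - (1 + \<beta> i * \<psi> i y) / 2)\<bar> \<le> dist x y"
    by (rule expectation_bounded_pmf)
  then show "\<bar>mean_payoff (signed_instance \<psi> \<beta>) x - mean_payoff (signed_instance \<psi> \<beta>) y\<bar> \<le> dist x y"
    unfolding mean_payoff_signed_instance[OF \<beta>]
    by (subst (asm) Bochner_Integration.integral_diff[OF integrable_mean[OF \<beta>] integrable_mean[OF \<beta>]])
qed (simp_all add: prob_space_signed_instance sets_signed_instance)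

text \<open>Take \<open>x n\<close> realising the pattern \<open>b\<close> on the first
  \<open>n\<close> levels. At every fixed level the integrand is eventually
  \<open>(1 + \<delta> i) / 2\<close>, and dominated convergence passes to the limit.\<close>

lemma SUP_mean_payoff_signed_instance:
  assumes \<delta>: "\<And>i. 0 \<le> \<delta> i" "\<And>i. \<delta> i \<le> 1" and b: "\<And>i. b i = 1 \<or> b i = (-1 :: real)"
  shows "measure_pmf.expectation (geometric_pmf (1/2)) (\<lambda>i. (1 + \<delta> i) / 2)
     \<le> (SUP x. mean_payoff (signed_instance \<psi> (\<lambda>i. b i * \<delta> i)) x)"
proof -
  let ?\<beta> = "\<lambda>i. b i * \<delta> i"
  have \<beta>: "\<bar>?\<beta> i\<bar> \<le> 1" for i
    using \<delta>[of i] b[of i] by auto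
  obtain x where x: "\<And>n i. i < n \<Longrightarrow> \<psi> i (x n) = b i"
    using \<psi>_pattern[of b] b by metis
  have bdd: "bdd_above (range (mean_payoff (signed_instance \<psi> ?\<beta>)))"
  proof (rule bdd_aboveI2)
    fix x
    have "\<bar>(1 + ?\<beta> i * \<psi> i x) / 2\<bar> \<le> 1" for i
      using mult_le_one_abs[OF \<beta>[of i] \<psi>_bounded[of i x]] by (simp add: abs_le_iff)
    from expectation_bounded_pmf[OF this, of "geometric_pmf (1/2)"]
    show "mean_payoff (signed_instance \<psi> ?\<beta>) x \<le> 1"
      unfolding mean_payoff_signed_instance[OF \<beta>] by (simp add: abs_le_iff)
  qed
  have "(\<lambda>n. mean_payoff (signed_instance \<psi> ?\<beta>) (x n))
     \<longlonglongrightarrow> measure_pmf.expectation (geometric_pmf (1/2)) (\<lambda>i. (1 + \<delta> i) / 2)"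
    unfolding mean_payoff_signed_instance[OF \<beta>]
  proof (rule integral_dominated_convergence[where w = "\<lambda>_. 1"])
    show "AE i in geometric_pmf (1/2). (\<lambda>n. (1 + ?\<beta> i * \<psi> i (x n)) / 2) \<longlonglongrightarrow> (1 + \<delta> i) / 2"
    proof (rule AE_I2)
      fix i
      have "(1 + \<delta> i) / 2 = (1 + ?\<beta> i * \<psi> i (x n)) / 2" if "n > i" for n
        using x[OF that] b[of i] by auto
      then show "(\<lambda>n. (1 + ?\<beta> i * \<psi> i (x n)) / 2) \<longlonglongrightarrow> (1 + \<delta> i) / 2"
        by (intro Lim_transform_eventually[OF tendsto_const])
           (auto intro: eventually_mono[OF eventually_gt_at_top[of i]])
    qed
    show "AE i in geometric_pmf (1/2). norm ((1 + ?\<beta> i * \<psi> i (x n)) / 2) \<le> 1" for n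
    proof (rule AE_I2)
      fix i
      show "norm ((1 + ?\<beta> i * \<psi> i (x n)) / 2) \<le> 1"
        using mult_le_one_abs[OF \<beta>[of i] \<psi>_bounded[of i "x n"]] by (simp add: abs_le_iff)
    qed
  qed auto
  then show ?thesis
    by (rule LIMSEQ_le_const2) (use bdd in \<open>auto intro!: cSUP_upper\<close>)
qed

text \<open>Every level yields at most \<open>(1 + \<delta> j) / 2\<close>. A wrong or zero sign at
  level \<open>i\<close> loses at least \<open>\<delta> i / 2\<close> there, and that level has
  weight \<open>(1/2) ^ (i + 1)\<close>.\<close>

lemma mean_payoff_wrong_sign:
  assumes \<delta>: "\<And>i. 0 \<le> \<delta> i" "\<And>i. \<delta> i \<le> 1" and b: "\<And>i. b i = 1 \<or> b i = (-1 :: real)"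
  shows "mean_payoff (signed_instance \<psi> (\<lambda>i. b i * \<delta> i)) x
     \<le> measure_pmf.expectation (geometric_pmf (1/2)) (\<lambda>i. (1 + \<delta> i) / 2)
        - (1/2) ^ (i + 2) * \<delta> i * (if b i * \<psi> i x \<le> 0 then 1 else 0)"
proof -
  let ?\<beta> = "\<lambda>i. b i * \<delta> i" and ?c = "\<delta> i / 2 * (if b i * \<psi> i x \<le> 0 then 1 else 0)"
  let ?E = "measure_pmf.expectation (geometric_pmf (1/2))"
  have \<beta>: "\<bar>?\<beta> i\<bar> \<le> 1" for i
    using \<delta>[of i] b[of i] by auto
  have i1: "integrable (geometric_pmf (1/2)) (\<lambda>i. (1 + \<delta> i) / 2)"
    by (rule integrable_bounded_pmf[where B = 1]) (use \<delta> in \<open>auto simp: abs_le_iff add_nonneg_nonneg intro: order_trans[of _ 0]\<close>)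
  have i2: "integrable (geometric_pmf (1/2)) (indicator {i} :: nat \<Rightarrow> real)"
    by (rule integrable_bounded_pmf[where B = 1]) auto
  have "?E (\<lambda>j. (1 + ?\<beta> j * \<psi> j x) / 2) \<le> ?E (\<lambda>j. (1 + \<delta> j) / 2 - ?c * indicator {i} j)"
  proof (rule integral_mono)
    show "integrable (geometric_pmf (1/2)) (\<lambda>j. (1 + \<delta> j) / 2 - ?c * indicator {i} j)"
      using i1 i2 by (intro Bochner_Integration.integrable_diff integrable_mult_right) auto
    fix j
    have le: "?\<beta> j * \<psi> j x \<le> \<delta> j"
    proof -
      have "b j * \<psi> j x \<le> 1"
        using b[of j] \<psi>_bounded[of j x] by auto
      then show ?thesis
        using mult_left_mono[of "b j * \<psi> j x" 1 "\<delta> j"] \<delta>(1)[of j] by (simp add: mult_ac)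
    qed
    moreover have "?\<beta> j * \<psi> j x \<le> 0" if "b j * \<psi> j x \<le> 0"
      using mult_left_mono[OF that \<delta>(1)[of j]] by (simp add: mult_ac)
    ultimately show "(1 + ?\<beta> j * \<psi> j x) / 2 \<le> (1 + \<delta> j) / 2 - ?c * indicator {i} j"
      using \<delta>(1)[of j] by (cases "j = i") (auto simp: field_simps)
  qed (rule integrable_mean[OF \<beta>])
  also have "\<dots> = ?E (\<lambda>j. (1 + \<delta> j) / 2) - ?c * (1/2) ^ (i + 1)"
    using i1 i2 expectation_indicator_pmf[of "geometric_pmf (1/2)" i]
    by (subst Bochner_Integration.integral_diff) auto
  finally show ?thesis
    unfolding mean_payoff_signed_instance[OF \<beta>] by (simp add: field_simps)
qed

end

text \<open>Builds the adversary's signs one by one. The value 0 marks the levels not yet decided,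
  which correspond to unbiased coins.\<close>

lemma greedy_sequence:
  fixes Q :: "(nat \<Rightarrow> real) \<Rightarrow> nat \<Rightarrow> real \<Rightarrow> bool"
  assumes "\<And>f i. \<exists>c. Q f i c"
  obtains b where "\<And>i. Q (\<lambda>j. if j < i then b j else 0) i (b i)"
proof -
  obtain ch where ch: "\<And>f i. Q f i (ch f i)"
    using assms by metis
  define B where "B = rec_nat (\<lambda>_. 0) (\<lambda>i f. f(i := ch f i))"
  have B0: "B 0 = (\<lambda>_. 0)" and BS: "B (Suc i) = (B i)(i := ch (B i) i)" for i
    by (simp_all add: B_def)
  have eq: "(\<lambda>j. if j < i then B (Suc j) j else 0) = B i" for i
    by (induction i) (auto simp: B0 BS fun_eq_iff less_Suc_eq)
  have "Q (\<lambda>j. if j < i then B (Suc j) j else 0) i (B (Suc i) i)" for i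
    unfolding eq by (simp add: BS ch)
  then show ?thesis
    by (rule that)
qed

text \<open>The power is at most \<open>exp y\<close> with \<open>y = real t * x\<close>, and
  \<open>exp y \<le> 1 + y + y\<^sup>2 \<le> 1 + 2 * y\<close> for
  \<open>0 \<le> y \<le> 1\<close>.\<close>

lemma one_plus_power_le:
  fixes x :: real
  assumes "0 \<le> x" "real t * x \<le> 1 / 32"
  shows "(1 + x) ^ t \<le> 1 + 1 / 16"
proof -
  have "(1 + x) ^ t \<le> exp x ^ t"
    using assms(1) exp_ge_add_one_self[of x] by (intro power_mono) auto
  also have "\<dots> = exp (real t * x)"
    by (simp add: exp_of_nat_mult)
  also have "\<dots> \<le> 1 + real t * x + (real t * x)\<^sup>2"
    using assms by (intro exp_bound) auto
  also have "\<dots> \<le> 1 + real t * x + real t * x"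
    using assms mult_left_le[of "real t * x" "real t * x"] zero_le_mult_iff[of "real t" x]
    unfolding power2_eq_square by linarith
  finally show ?thesis
    using assms(2) by linarith
qed

lemma continuous_mean_payoff:
  assumes "experts_instance P"
  shows "continuous_on UNIV (mean_payoff P)"
proof -
  have "1-lipschitz_on UNIV (mean_payoff P)"
    using assms by (intro lipschitz_onI) (auto simp: experts_instance_def dist_real_def)
  then show ?thesis
    by (rule lipschitz_on_continuous_on)
qed

lemma mean_payoff_bounded:
  assumes "experts_instance P"
  shows "0 \<le> mean_payoff P x" "mean_payoff P x \<le> 1"
proof -
  interpret prob_space P
    using assms by (simp add: experts_instance_def)
  have s: "sets P = sets payoff_space"
    using assms by (simp add: experts_instance_def)
  have f: "0 \<le> f x \<and> f x \<le> 1" if "f \<in> space P" for f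
    using that by (auto simp: space_payoff_space sets_eq_imp_space_eq[OF s])
  have "integrable P (\<lambda>f. f x)"
    by (rule integrable_const_bound[where B = 1])
       (use f in \<open>auto simp: measurable_cong_sets[OF s refl]\<close>)
  then have "mean_payoff P x \<le> (\<integral>f. 1 \<partial>P)"
    unfolding mean_payoff_def by (intro integral_mono) (use f in auto)
  then show "mean_payoff P x \<le> 1"
    by (simp add: prob_space)
  show "0 \<le> mean_payoff P x"
    unfolding mean_payoff_def by (intro integral_nonneg_AE AE_I2) (use f in auto)
qed

section \<open>A fixed strategy against the signed instances\<close>

locale seeded_strategy = sign_functions \<psi> Lip
  for \<psi> :: "nat \<Rightarrow> 'a::metric_space \<Rightarrow> real" and Lip +
  fixes W :: "real measure" and \<sigma> :: "'a strategy"
  assumes W: "prob_space W" "sets W = sets borel" and \<sigma>: "\<sigma> \<in> full_feedback"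
begin

abbreviation joint :: "(nat \<Rightarrow> real) \<Rightarrow> (real \<times> (nat \<Rightarrow> 'a \<Rightarrow> real)) measure" where
  "joint \<beta> \<equiv> W \<Otimes>\<^sub>M (\<Pi>\<^sub>M _\<in>(UNIV :: nat set). signed_instance \<psi> \<beta>)"

lemma sets_joint: "sets (joint \<beta>) = sets (borel \<Otimes>\<^sub>M (\<Pi>\<^sub>M _\<in>(UNIV :: nat set). payoff_space))"
  by (intro sets_pair_measure_cong sets_PiM_cong W refl sets_signed_instance)

lemma prob_space_sequence: "prob_space (\<Pi>\<^sub>M _\<in>(UNIV :: nat set). signed_instance \<psi> \<beta>)"
  by (intro prob_space_PiM prob_space_signed_instance)

lemma prob_space_joint: "prob_space (joint \<beta>)"
  by (intro prob_space_pair W prob_space_sequence)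

lemma integrable_joint:
  fixes h :: "real \<times> (nat \<Rightarrow> 'a \<Rightarrow> real) \<Rightarrow> real"
  assumes "h \<in> borel_measurable (borel \<Otimes>\<^sub>M (\<Pi>\<^sub>M _\<in>(UNIV :: nat set). payoff_space))"
    and "\<And>x. \<bar>h x\<bar> \<le> B"
  shows "integrable (joint \<beta>) h"
proof -
  interpret prob_space "joint \<beta>"
    by (rule prob_space_joint)
  show ?thesis
    by (rule integrable_const_bound[where B = B])
       (use assms in \<open>auto simp: sets_joint cong: measurable_cong_sets\<close>)
qed

lemma pick_measurable_comp:
  assumes "continuous_on UNIV f"
  shows "(\<lambda>(\<omega>, F). f (pick \<sigma> \<omega> F s)) \<in> borel_measurable (borel \<Otimes>\<^sub>M (\<Pi>\<^sub>M _\<in>(UNIV :: nat set). payoff_space))"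
  using measurable_compose[OF pick_measurable[OF \<sigma>, of s] borel_measurable_continuous_onI[OF assms]]
  by (simp add: split_beta')

lemma continuous_psi: "continuous_on UNIV (\<psi> i)"
proof -
  have "\<bar>Lip i\<bar>-lipschitz_on UNIV (\<psi> i)"
  proof (rule lipschitz_onI)
    fix x y :: 'a
    have "Lip i * dist x y \<le> \<bar>Lip i\<bar> * dist x y"
      by (intro mult_right_mono) auto
    then show "dist (\<psi> i x) (\<psi> i y) \<le> \<bar>Lip i\<bar> * dist x y"
      using \<psi>_Lipschitz[of i x y] by (simp add: dist_real_def)
  qed auto
  then show ?thesis
    by (rule lipschitz_on_continuous_on)
qed

text \<open>Biases of size at most \<open>\<delta>\<close> cannot be detected within
  \<open>t\<close> rounds if \<open>t * \<delta>\<^sup>2\<close> is small. Once the seed is fixed by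
  Fubini, the strategy is a deterministic function of the payoffs and the bound for \<open>t\<close>
  discrete samples applies; integrating over the seed preserves it.\<close>

lemma expectation_joint_close:
  fixes h :: "real \<times> (nat \<Rightarrow> 'a \<Rightarrow> real) \<Rightarrow> real"
  assumes \<beta>: "\<And>j. \<bar>\<beta> j\<bar> \<le> 1" and \<beta>': "\<And>j. \<bar>\<beta>' j\<bar> \<le> 1"
    and eq: "\<And>j. \<beta> j = \<beta>' j \<or> \<beta> j = 0 \<and> \<bar>\<beta>' j\<bar> \<le> \<delta>"
    and t: "real t * \<delta>\<^sup>2 \<le> 1 / 32"
    and h: "h \<in> borel_measurable (borel \<Otimes>\<^sub>M (\<Pi>\<^sub>M _\<in>(UNIV :: nat set). payoff_space))"
    and h01: "\<And>x. 0 \<le> h x" "\<And>x. h x \<le> 1"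
    and dep: "\<And>\<omega> F G. (\<And>s. s < t \<Longrightarrow> F s = G s) \<Longrightarrow> h (\<omega>, F) = h (\<omega>, G)"
  shows "\<bar>(\<integral>x. h x \<partial>joint \<beta>') - (\<integral>x. h x \<partial>joint \<beta>)\<bar> \<le> 1 / 4"
proof -
  interpret W: prob_space W
    by (rule W)
  let ?S = "\<lambda>\<beta>. \<Pi>\<^sub>M _\<in>(UNIV :: nat set). signed_instance \<psi> \<beta>"
  let ?l = "\<lambda>(j, s). if \<beta> j = \<beta>' j then 1 else if s then 1 + \<beta>' j else 1 - \<beta>' j"
  interpret tilted_pmf "signed_coin \<beta>" "signed_coin \<beta>'" ?l
    using eq by (intro tilted_signed_coin \<beta> \<beta>') blast
  have hb: "\<bar>h x\<bar> \<le> 1" for x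
    using h01[of x] by simp
  have int: "integrable (joint \<gamma>) h" for \<gamma>
    using h hb by (rule integrable_joint)
  have fub: "(\<integral>x. h x \<partial>joint \<gamma>) = (\<integral>\<omega>. \<integral>F. h (\<omega>, F) \<partial>?S \<gamma> \<partial>W)"
    and intW: "integrable W (\<lambda>\<omega>. \<integral>F. h (\<omega>, F) \<partial>?S \<gamma>)" for \<gamma>
  proof -
    interpret S: prob_space "?S \<gamma>"
      by (rule prob_space_sequence)
    interpret pair_prob_space W "?S \<gamma>" ..
    show "(\<integral>x. h x \<partial>joint \<gamma>) = (\<integral>\<omega>. \<integral>F. h (\<omega>, F) \<partial>?S \<gamma> \<partial>W)"
      using integral_fst'[OF int] by simp
    show "integrable W (\<lambda>\<omega>. \<integral>F. h (\<omega>, F) \<partial>?S \<gamma>)"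
      using integrable_fst'[OF int] .
  qed
  have close: "\<bar>(\<integral>F. h (\<omega>, F) \<partial>?S \<beta>') - (\<integral>F. h (\<omega>, F) \<partial>?S \<beta>)\<bar> \<le> 1 / 4" for \<omega>
  proof -
    have sec: "(\<lambda>F. h (\<omega>, F)) \<in> borel_measurable (\<Pi>\<^sub>M _\<in>(UNIV :: nat set). payoff_space)"
      by (rule measurable_compose[OF measurable_Pair1' h]) simp
    have unroll: "(\<integral>F. h (\<omega>, F) \<partial>?S \<gamma>) = measure_pmf.expectation (replicate_pmf t (signed_coin \<gamma>))
        (\<lambda>zs. h (\<omega>, \<lambda>s. if s < t then signed_payoff \<psi> (zs ! s) else signed_payoff \<psi> (0, True)))" for \<gamma>
      unfolding signed_instance_def
      by (rule expectation_PiM_unroll[where B = 1]) (rule signed_payoff_in_space sec hb dep | assumption)+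
    have "measure_pmf.expectation (signed_coin \<beta>) (\<lambda>z. (?l z)\<^sup>2) ^ t \<le> (1 + \<delta>\<^sup>2) ^ t"
      by (intro power_mono expectation_signed_coin_tilt_sq \<beta> \<beta>' eq) auto
    also have "\<dots> \<le> 1 + 1 / 16"
      using t by (intro one_plus_power_le) auto
    finally show ?thesis
      unfolding unroll by (intro expectation_replicate_close h01)
  qed
  have "\<bar>(\<integral>x. h x \<partial>joint \<beta>') - (\<integral>x. h x \<partial>joint \<beta>)\<bar>
      = \<bar>\<integral>\<omega>. (\<integral>F. h (\<omega>, F) \<partial>?S \<beta>') - (\<integral>F. h (\<omega>, F) \<partial>?S \<beta>) \<partial>W\<bar>"
    by (simp add: fub Bochner_Integration.integral_diff[OF intW intW])
  also have "\<dots> \<le> (\<integral>\<omega>. \<bar>(\<integral>F. h (\<omega>, F) \<partial>?S \<beta>') - (\<integral>F. h (\<omega>, F) \<partial>?S \<beta>)\<bar> \<partial>W)"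
    by (rule integral_abs_bound)
  also have "\<dots> \<le> (\<integral>\<omega>. 1 / 4 \<partial>W)"
    by (intro integral_mono close integrable_abs Bochner_Integration.integrable_diff intW) auto
  finally show ?thesis
    by (simp add: W.prob_space)
qed

text \<open>The value 0 of \<open>\<psi> i\<close> counts as wrong for both signs, so in every round
  at least one of the signs 1 and -1 is missed.\<close>

definition wrong :: "nat \<Rightarrow> real \<Rightarrow> nat \<Rightarrow> real \<times> (nat \<Rightarrow> 'a \<Rightarrow> real) \<Rightarrow> real" where
  "wrong i c s = (\<lambda>(\<omega>, F). if c * \<psi> i (pick \<sigma> \<omega> F s) \<le> 0 then 1 else 0)"

lemma wrong_measurable: "wrong i c s \<in> borel_measurable (borel \<Otimes>\<^sub>M (\<Pi>\<^sub>M _\<in>(UNIV :: nat set). payoff_space))"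
proof -
  have [measurable]: "(\<lambda>z. \<psi> i (pick \<sigma> (fst z) (snd z) s)) \<in> borel_measurable (borel \<Otimes>\<^sub>M (\<Pi>\<^sub>M _\<in>(UNIV :: nat set). payoff_space))"
    using pick_measurable_comp[OF continuous_psi, of i s] by (simp add: split_beta')
  show ?thesis
    unfolding wrong_def split_beta' by measurable
qed

lemma wrong_bounds: "0 \<le> wrong i c s x" "wrong i c s x \<le> 1" "\<bar>wrong i c s x\<bar> \<le> 1"
  by (auto simp: wrong_def split_beta')

lemma integrable_wrong: "integrable (joint \<beta>) (wrong i c s)"
  using wrong_measurable wrong_bounds(3) by (rule integrable_joint)

text \<open>The expected numbers of rounds that are wrong for 1 and for -1 add up to at least
  \<open>t\<close>, so one of them is at least half of it.\<close>

lemma wrong_either: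
  "(\<exists>c\<in>{1, -1}. real t / 2 \<le> (\<Sum>s<t. \<integral>x. wrong i c s x \<partial>joint \<beta>))"
proof -
  interpret prob_space "joint \<beta>"
    by (rule prob_space_joint)
  have "1 \<le> (\<integral>x. wrong i 1 s x \<partial>joint \<beta>) + (\<integral>x. wrong i (-1) s x \<partial>joint \<beta>)" for s
  proof -
    have "(\<integral>x. 1 \<partial>joint \<beta>) \<le> (\<integral>x. wrong i 1 s x + wrong i (-1) s x \<partial>joint \<beta>)"
      by (intro integral_mono Bochner_Integration.integrable_add integrable_wrong) (auto simp: wrong_def split_beta')
    then show ?thesis
      by (simp add: integrable_wrong prob_space)
  qed
  then have "(\<Sum>s<t. 1) \<le> (\<Sum>s<t. (\<integral>x. wrong i 1 s x \<partial>joint \<beta>) + (\<integral>x. wrong i (-1) s x \<partial>joint \<beta>))"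
    by (intro sum_mono)
  then show ?thesis
    by (simp add: sum.distrib) linarith
qed

lemma regret_lower_bound:
  assumes \<delta>: "\<And>i. 0 \<le> \<delta> i" "\<And>i. \<delta> i \<le> 1" and b: "\<And>i. b i = 1 \<or> b i = (-1 :: real)"
    and Lip: "\<And>i. \<delta> i * Lip i \<le> 1"
  shows "(1/2) ^ (i + 2) * \<delta> i * (\<Sum>s<t. \<integral>x. wrong i (b i) s x \<partial>joint (\<lambda>i. b i * \<delta> i))
      \<le> regret W \<sigma> (signed_instance \<psi> (\<lambda>i. b i * \<delta> i)) t"
proof -
  let ?\<beta> = "\<lambda>i. b i * \<delta> i"
  let ?P = "signed_instance \<psi> ?\<beta>"
  let ?M = "measure_pmf.expectation (geometric_pmf (1/2)) (\<lambda>i. (1 + \<delta> i) / 2)"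
  interpret J: prob_space "joint ?\<beta>"
    by (rule prob_space_joint)
  have "\<bar>?\<beta> i\<bar> = \<delta> i" for i
    using b[of i] \<delta>(1)[of i] by auto
  then have P: "experts_instance ?P"
    using \<delta> Lip by (intro experts_instance_signed_instance) auto
  have intm: "integrable (joint ?\<beta>) (\<lambda>(\<omega>, F). mean_payoff ?P (pick \<sigma> \<omega> F s))" for s
    using pick_measurable_comp[OF continuous_mean_payoff[OF P]]
    by (rule integrable_joint[where B = 1]) (use mean_payoff_bounded[OF P] in auto)
  have "(\<integral>(\<omega>, F). (\<Sum>s<t. mean_payoff ?P (pick \<sigma> \<omega> F s)) \<partial>joint ?\<beta>)
      = (\<Sum>s<t. \<integral>(\<omega>, F). mean_payoff ?P (pick \<sigma> \<omega> F s) \<partial>joint ?\<beta>)"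
    using intm by (simp add: split_beta')
  also have "\<dots> \<le> (\<Sum>s<t. ?M - (1/2) ^ (i + 2) * \<delta> i * (\<integral>x. wrong i (b i) s x \<partial>joint ?\<beta>))"
  proof (rule sum_mono)
    fix s
    have "(\<integral>(\<omega>, F). mean_payoff ?P (pick \<sigma> \<omega> F s) \<partial>joint ?\<beta>)
      \<le> (\<integral>x. ?M - (1/2) ^ (i + 2) * \<delta> i * wrong i (b i) s x \<partial>joint ?\<beta>)"
      by (rule integral_mono[OF intm])
         (use mean_payoff_wrong_sign[of \<delta> b _ i] \<delta> b in
          \<open>auto simp: wrong_def split_beta' integrable_wrong[unfolded wrong_def split_beta']\<close>)
    also have "\<dots> = ?M - (1/2) ^ (i + 2) * \<delta> i * (\<integral>x. wrong i (b i) s x \<partial>joint ?\<beta>)"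
      by (simp add: integrable_wrong J.prob_space)
    finally show "(\<integral>(\<omega>, F). mean_payoff ?P (pick \<sigma> \<omega> F s) \<partial>joint ?\<beta>)
      \<le> ?M - (1/2) ^ (i + 2) * \<delta> i * (\<integral>x. wrong i (b i) s x \<partial>joint ?\<beta>)" .
  qed
  also have "\<dots> = real t * ?M - (1/2) ^ (i + 2) * \<delta> i * (\<Sum>s<t. \<integral>x. wrong i (b i) s x \<partial>joint ?\<beta>)"
    by (simp add: sum_subtractf sum_distrib_left)
  finally show ?thesis
    using mult_left_mono[OF SUP_mean_payoff_signed_instance[of \<delta> b], of "real t"] \<delta> b
    unfolding regret_def by auto
qed

text \<open>The biases satisfy \<open>N i * (\<delta> i)\<^sup>2 = 1 / 32\<close>, the threshold of
  detectability at time \<open>N i\<close>, and are small enough for the Lipschitz condition. Seeing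
  the true instance instead of the one unbiased from level \<open>i\<close> on lowers the expected
  number of wrong rounds from \<open>N i / 2\<close> to no less than \<open>N i / 4\<close>.\<close>

lemma hard_instance:
  assumes N: "\<And>i. 0 < N i" "\<And>i j. i \<le> j \<Longrightarrow> N i \<le> N j"
    and Lip: "\<And>i. Lip i \<le> sqrt (32 * real (N i))"
  obtains P where "experts_instance P"
    "\<And>i. (1/2) ^ (i + 8) * sqrt (real (N i)) \<le> regret W \<sigma> P (N i)"
proof -
  define \<delta> where "\<delta> i = 1 / sqrt (32 * real (N i))" for i
  have \<delta>0: "0 \<le> \<delta> i" for i
    by (simp add: \<delta>_def)
  have \<delta>1: "\<delta> i \<le> 1" for i
    using N(1)[of i] by (simp add: \<delta>_def Suc_le_eq divide_le_eq_1)
  have \<delta>mono: "\<delta> j \<le> \<delta> i" if "i \<le> j" for i j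
    using N(1)[of i] N(2)[OF that] by (simp add: \<delta>_def frac_le)
  have \<delta>L: "\<delta> i * Lip i \<le> 1" for i
    using Lip[of i] N(1)[of i] by (simp add: \<delta>_def divide_le_eq)
  \<comment> \<open>The sign at level \<open>i\<close> is chosen against the behaviour of the
    strategy when levels \<open>i\<close> and above are unbiased, so it depends only on earlier
    signs.\<close>
  obtain b where b: "\<And>i. b i \<in> {1, -1} \<and> real (N i) / 2
      \<le> (\<Sum>s<N i. \<integral>x. wrong i (b i) s x \<partial>joint (\<lambda>j. (if j < i then b j else 0) * \<delta> j))"
    by (rule greedy_sequence[of "\<lambda>f i c. c \<in> {1, -1} \<and> real (N i) / 2
      \<le> (\<Sum>s<N i. \<integral>x. wrong i c s x \<partial>joint (\<lambda>j. f j * \<delta> j))"])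
       (use wrong_either in blast)+
  have b1: "b i = 1 \<or> b i = -1" for i
    using b[of i] by auto
  let ?P = "signed_instance \<psi> (\<lambda>i. b i * \<delta> i)"
  have abs\<beta>: "\<bar>b i * \<delta> i\<bar> = \<delta> i" for i
    using b1[of i] \<delta>0[of i] by auto
  show ?thesis
  proof (rule that[of ?P])
    show "experts_instance ?P"
      using \<delta>1 \<delta>L abs\<beta> by (intro experts_instance_signed_instance) auto
    fix i
    have close: "(\<integral>x. wrong i (b i) s x \<partial>joint (\<lambda>j. (if j < i then b j else 0) * \<delta> j)) - 1 / 4
        \<le> (\<integral>x. wrong i (b i) s x \<partial>joint (\<lambda>j. b j * \<delta> j))" if "s < N i" for s
    proof -
      have "\<bar>(\<integral>x. wrong i (b i) s x \<partial>joint (\<lambda>j. b j * \<delta> j))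
          - (\<integral>x. wrong i (b i) s x \<partial>joint (\<lambda>j. (if j < i then b j else 0) * \<delta> j))\<bar> \<le> 1 / 4"
      proof (rule expectation_joint_close[where \<delta> = "\<delta> i" and t = "N i"])
        show "\<bar>(if j < i then b j else 0) * \<delta> j\<bar> \<le> 1" for j
          using abs\<beta>[of j] \<delta>1[of j] by auto
        show "\<bar>b j * \<delta> j\<bar> \<le> 1" for j
          using abs\<beta>[of j] \<delta>1[of j] by auto
        \<comment> \<open>The instances differ only from level \<open>i\<close> on, where the biases
          are at most \<open>\<delta> i\<close> because \<open>N\<close> is monotone.\<close>
        show "(if j < i then b j else 0) * \<delta> j = b j * \<delta> j \<or>
            (if j < i then b j else 0) * \<delta> j = 0 \<and> \<bar>b j * \<delta> j\<bar> \<le> \<delta> i" for j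
          using abs\<beta>[of j] \<delta>mono[of i j] by auto
        show "real (N i) * (\<delta> i)\<^sup>2 \<le> 1 / 32"
          using N(1)[of i] by (simp add: \<delta>_def power_divide)
        show "wrong i (b i) s (\<omega>, F) = wrong i (b i) s (\<omega>, G)" if "\<And>r. r < N i \<Longrightarrow> F r = G r" for \<omega> F G
          using that \<open>s < N i\<close> pick_cong[of s F G \<sigma> \<omega>] by (simp add: wrong_def)
      qed (rule wrong_measurable wrong_bounds)+
      then show ?thesis
        by linarith
    qed
    have "real (N i) / 4 = real (N i) / 2 - (\<Sum>s<N i. 1 / 4)"
      by simp
    also have "\<dots> \<le> (\<Sum>s<N i. (\<integral>x. wrong i (b i) s x \<partial>joint (\<lambda>j. (if j < i then b j else 0) * \<delta> j)) - 1 / 4)"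
      using b[of i] by (simp add: sum_subtractf)
    also have "\<dots> \<le> (\<Sum>s<N i. \<integral>x. wrong i (b i) s x \<partial>joint (\<lambda>j. b j * \<delta> j))"
      using close by (intro sum_mono) auto
    finally have "(1/2) ^ (i + 2) * \<delta> i * (real (N i) / 4)
       \<le> (1/2) ^ (i + 2) * \<delta> i * (\<Sum>s<N i. \<integral>x. wrong i (b i) s x \<partial>joint (\<lambda>j. b j * \<delta> j))"
      using \<delta>0[of i] by (intro mult_left_mono) auto
    also have "\<dots> \<le> regret W \<sigma> ?P (N i)"
      by (rule regret_lower_bound) (use \<delta>0 \<delta>1 \<delta>L b1 in auto)
    finally have r: "(1/2) ^ (i + 2) * \<delta> i * (real (N i) / 4) \<le> regret W \<sigma> ?P (N i)" .
    \<comment> \<open>Replacing \<open>sqrt 32\<close> by 16 makes the constant a power of two: 1/16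
      times 1/4 supplies the six extra factors 1/2 in \<open>(1/2) ^ (i + 8)\<close>.\<close>
    have "sqrt 32 \<le> sqrt (16\<^sup>2 :: real)"
      by (intro real_sqrt_le_mono) auto
    then have s32: "sqrt 32 \<le> (16 :: real)"
      by simp
    have "(1/2) ^ (i + 8) * sqrt (real (N i)) = (1/2) ^ (i + 2) * (1 / 16 * sqrt (real (N i)) / 4)"
      by (simp add: power_add power_one_over)
    also have "\<dots> \<le> (1/2) ^ (i + 2) * (1 / sqrt 32 * sqrt (real (N i)) / 4)"
      using s32 by (intro mult_left_mono divide_right_mono mult_right_mono frac_le) auto
    also have "\<dots> = (1/2) ^ (i + 2) * \<delta> i * (real (N i) / 4)"
      using N(1)[of i] by (simp add: \<delta>_def real_sqrt_mult field_simps)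
    finally show "(1/2) ^ (i + 8) * sqrt (real (N i)) \<le> regret W \<sigma> ?P (N i)"
      using r by linarith
  qed
qed

end

text \<open>The times \<open>N i\<close> are taken so sparse that
  \<open>\<bar>g (N i)\<bar> \<le> (1/4) ^ i * sqrt (N i)\<close>. Tractability with constant
  \<open>C\<close> would then force \<open>(1/2) ^ (i + 8) \<le> \<bar>C\<bar> * (1/4) ^ i\<close>,
  that is, \<open>2 ^ i \<le> 256 * \<bar>C\<bar>\<close> for all \<open>i\<close>.\<close>

lemma (in sign_functions) not_tractable:
  assumes g: "(\<lambda>t. g t / sqrt (real t)) \<longlonglongrightarrow> 0"
  shows "\<not> tractable (full_feedback :: 'a strategy set) g"
proof
  assume "tractable (full_feedback :: 'a strategy set) g"
  then obtain W \<sigma> where W: "prob_space W" "sets W = sets borel" and \<sigma>: "(\<sigma> :: 'a strategy) \<in> full_feedback"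
    and reg: "\<And>P. experts_instance P \<Longrightarrow> \<exists>C. \<forall>t\<ge>1. regret W \<sigma> P t \<le> C * g t"
    unfolding tractable_def by blast
  interpret seeded_strategy \<psi> Lip W \<sigma>
    by (intro seeded_strategy.intro sign_functions_axioms seeded_strategy_axioms.intro W \<sigma>)
  define Q where "Q i n0 n \<longleftrightarrow> n > n0 \<and> \<bar>g n\<bar> \<le> (1/4) ^ i * sqrt (real n) \<and> Lip i \<le> sqrt (32 * real n)"
    for i n0 n :: nat
  have "\<exists>n. Q i n0 n" for i n0
  proof -
    have "\<forall>\<^sub>F n in sequentially. \<bar>g n / sqrt (real n)\<bar> < (1/4) ^ i"
      using tendstoD[OF g, of "(1/4) ^ i"] by (simp add: dist_real_def)
    moreover have "\<forall>\<^sub>F n in sequentially. n > max n0 (nat \<lceil>(Lip i)\<^sup>2\<rceil>)"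
      by (rule eventually_gt_at_top)
    ultimately have "\<forall>\<^sub>F n in sequentially. \<bar>g n / sqrt (real n)\<bar> < (1/4) ^ i \<and> n > max n0 (nat \<lceil>(Lip i)\<^sup>2\<rceil>)"
      by (rule eventually_conj)
    then obtain n where n: "\<bar>g n / sqrt (real n)\<bar> < (1/4) ^ i" "n > n0" "n > nat \<lceil>(Lip i)\<^sup>2\<rceil>"
      by (auto dest!: eventually_happens)
    have "(Lip i)\<^sup>2 \<le> 32 * real n"
      using n(3) by linarith
    then have "Lip i \<le> sqrt (32 * real n)"
      by (rule real_le_rsqrt)
    moreover have "\<bar>g n\<bar> \<le> (1/4) ^ i * sqrt (real n)"
      using n by (simp add: abs_divide divide_less_eq)
    ultimately show ?thesis
      using n unfolding Q_def by blast
  qed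
  then obtain f where f: "\<And>i n0. Q i n0 (f i n0)"
    by metis
  define N where "N = rec_nat (f 0 0) (\<lambda>i n. f (Suc i) n)"
  have N0: "N 0 = f 0 0" and NS: "N (Suc i) = f (Suc i) (N i)" for i
    by (simp_all add: N_def)
  have "\<exists>n0. Q i n0 (N i)" for i
    by (cases i) (auto simp: N0 NS intro: f)
  then have Ng: "\<bar>g (N i)\<bar> \<le> (1/4) ^ i * sqrt (real (N i))" "Lip i \<le> sqrt (32 * real (N i))"
    and pos: "0 < N i" for i
    unfolding Q_def by (metis gr_implies_not0 not_gr_zero)+
  have mono: "N i \<le> N j" if "i \<le> j" for i j
    using that by (rule lift_Suc_mono_le[of N, rotated]) (use f in \<open>simp add: NS Q_def less_imp_le\<close>)
  obtain P where P: "experts_instance P"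
    and low: "\<And>i. (1/2) ^ (i + 8) * sqrt (real (N i)) \<le> regret W \<sigma> P (N i)"
    using hard_instance[of N, OF pos mono Ng(2)] by blast
  obtain C where C: "\<And>t. t \<ge> 1 \<Longrightarrow> regret W \<sigma> P t \<le> C * g t"
    using reg[OF P] by blast
  have "(2 :: real) ^ i \<le> 256 * \<bar>C\<bar>" for i
  proof -
    have "(1/2) ^ (i + 8) * sqrt (real (N i)) \<le> C * g (N i)"
      using low[of i] C[of "N i"] pos[of i] by linarith
    also have "\<dots> \<le> \<bar>C\<bar> * \<bar>g (N i)\<bar>"
      by (metis abs_ge_self abs_mult)
    also have "\<dots> \<le> \<bar>C\<bar> * ((1/4) ^ i * sqrt (real (N i)))"
      by (intro mult_left_mono Ng) auto
    finally have "(1/2) ^ (i + 8) * sqrt (real (N i)) \<le> (\<bar>C\<bar> * (1/4) ^ i) * sqrt (real (N i))"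
      by (simp add: mult.assoc)
    then have "(1/2) ^ (i + 8) \<le> \<bar>C\<bar> * (1/4) ^ i"
      using pos[of i] by (simp add: mult_le_cancel_right)
    then have "(1/2) ^ (i + 8) * 4 ^ i * 256 \<le> \<bar>C\<bar> * (1/4) ^ i * 4 ^ i * 256"
      by (intro mult_right_mono) auto
    moreover have "(4 :: real) ^ i = 2 ^ i * 2 ^ i"
      by (simp flip: power_mult_distrib)
    ultimately show ?thesis
      by (simp add: power_add power_one_over)
  qed
  moreover obtain i where "256 * \<bar>C\<bar> < (2 :: real) ^ i"
    using real_arch_pow[of 2 "256 * \<bar>C\<bar>"] by auto
  ultimately show False
    by (meson not_less)
qed

section \<open>Sign functions from the geometry of the completion\<close>

locale metric_compl =
  fixes m :: "'b metric" and \<iota> :: "'a::metric_space \<Rightarrow> 'b"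
  assumes completion: "metric_completion m \<iota>"
begin

sublocale K: Metric_space "mspace m" "mdist m"
  by (rule Metric_space_mspace_mdist)

lemma mtopology_eq: "mtopology_of m = K.mtopology"
  by (simp add: mtopology_of_def)

lemma mcomplete: "K.mcomplete"
  using completion by (simp add: metric_completion_def mcomplete_of_def)

lemma \<iota>_in [simp]: "\<iota> x \<in> mspace m"
  using completion by (auto simp: metric_completion_def)

lemma mdist_\<iota>: "mdist m (\<iota> x) (\<iota> y) = dist x y"
  using completion by (simp add: metric_completion_def)

lemma dense:
  assumes "c \<in> mspace m" "e > 0"
  shows "\<exists>x. mdist m c (\<iota> x) < e"
proof -
  have "c \<in> K.mtopology closure_of range \<iota>"
    using completion assms by (simp add: metric_completion_def mtopology_eq)
  then show ?thesis
    using assms by (auto simp: K.metric_closure_of)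
qed

definition set_dist :: "'b set \<Rightarrow> 'b \<Rightarrow> real" where
  "set_dist S p = (INF q\<in>S. mdist m p q)"

lemma set_dist_le: "q \<in> S \<Longrightarrow> set_dist S p \<le> mdist m p q"
  unfolding set_dist_def by (intro cINF_lower bdd_belowI2[where m = 0]) auto

lemma set_dist_ge: "S \<noteq> {} \<Longrightarrow> (\<And>q. q \<in> S \<Longrightarrow> r \<le> mdist m p q) \<Longrightarrow> r \<le> set_dist S p"
  unfolding set_dist_def by (intro cINF_greatest)

lemma set_dist_triangle:
  assumes "S \<noteq> {}" "S \<subseteq> mspace m" "p \<in> mspace m" "p' \<in> mspace m"
  shows "set_dist S p \<le> set_dist S p' + mdist m p p'"
proof -
  have "set_dist S p - mdist m p p' \<le> set_dist S p'"
  proof (rule set_dist_ge[OF assms(1)])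
    fix q assume q: "q \<in> S"
    then have "mdist m p q \<le> mdist m p p' + mdist m p' q"
      using assms by (intro K.triangle) auto
    then show "set_dist S p - mdist m p p' \<le> mdist m p' q"
      using set_dist_le[OF q, of p] by linarith
  qed
  then show ?thesis
    by linarith
qed

text \<open>\<open>\<psi> i\<close> is a truncated, scaled difference of the distances to
  \<open>C i False\<close> and \<open>C i True\<close>. A common point \<open>c\<close> may lie
  outside \<open>X\<close>; moving from it to a point of \<open>X\<close> within
  \<open>d i / 4\<close> leaves the difference of distances at least \<open>d i / 2\<close> in
  absolute value, and the factor \<open>2 / d i\<close> brings it back to the truncation level
  1.\<close>

lemma sign_functions_of_separated_pairs:
  fixes C :: "nat \<Rightarrow> bool \<Rightarrow> 'b set" and d :: "nat \<Rightarrow> real"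
  assumes sub: "\<And>i b. C i b \<subseteq> mspace m"
    and pos: "\<And>i. 0 < d i"
    and sep: "\<And>i p q. p \<in> C i True \<Longrightarrow> q \<in> C i False \<Longrightarrow> d i \<le> mdist m p q"
    and pat: "\<And>b n. \<exists>c\<in>mspace m. \<forall>i<n. c \<in> C i (b i)"
  shows "\<exists>(\<psi> :: nat \<Rightarrow> 'a \<Rightarrow> real) Lip. sign_functions \<psi> Lip"
proof -
  define D where "D i x = 2 * (set_dist (C i False) (\<iota> x) - set_dist (C i True) (\<iota> x)) / d i" for i x
  define \<psi> where "\<psi> i x = max (-1) (min 1 (D i x))" for i x
  have ne: "C i b \<noteq> {}" for i b
    using pat[of "Suc i" "\<lambda>_. b"] by blast
  have D_Lip: "D i x - D i y \<le> 4 / d i * dist x y" for i x y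
  proof -
    have "set_dist (C i False) (\<iota> x) \<le> set_dist (C i False) (\<iota> y) + dist x y"
      using set_dist_triangle[OF ne sub \<iota>_in \<iota>_in, of i False x y] by (simp add: mdist_\<iota>)
    moreover have "set_dist (C i True) (\<iota> y) \<le> set_dist (C i True) (\<iota> x) + dist x y"
      using set_dist_triangle[OF ne sub \<iota>_in \<iota>_in, of i True y x] by (simp add: mdist_\<iota> dist_commute)
    ultimately have "2 * (set_dist (C i False) (\<iota> x) - set_dist (C i True) (\<iota> x))
        \<le> 2 * (set_dist (C i False) (\<iota> y) - set_dist (C i True) (\<iota> y)) + 4 * dist x y"
      by simp
    from divide_right_mono[OF this, of "d i"] show ?thesis
      using pos[of i] by (simp add: D_def add_divide_distrib)
  qed
  have near: "\<psi> i x = (if b then 1 else -1)"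
    if c: "c \<in> C i b" "c \<in> mspace m" "mdist m c (\<iota> x) \<le> d i / 4" for i b c x
  proof -
    have "set_dist (C i b) (\<iota> x) \<le> d i / 4"
      using set_dist_le[OF c(1), of "\<iota> x"] c(3) K.commute[of c "\<iota> x"] by linarith
    moreover have "d i \<le> set_dist (C i (\<not> b)) c"
    proof (rule set_dist_ge[OF ne])
      fix q assume "q \<in> C i (\<not> b)"
      then show "d i \<le> mdist m c q"
        using sep[of c i q] sep[of q i c] c(1) K.commute[of c q] by (cases b) auto
    qed
    ultimately have "d i / 2 \<le> set_dist (C i (\<not> b)) (\<iota> x) - set_dist (C i b) (\<iota> x)"
      using set_dist_triangle[OF ne sub c(2) \<iota>_in, of i "\<not> b" x] c(3) by linarith
    then have "1 \<le> 2 * (set_dist (C i (\<not> b)) (\<iota> x) - set_dist (C i b) (\<iota> x)) / d i"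
      using pos[of i] by (simp add: field_simps)
    moreover have "2 * (set_dist (C i False) (\<iota> x) - set_dist (C i True) (\<iota> x)) / d i
       = - (2 * (set_dist (C i True) (\<iota> x) - set_dist (C i False) (\<iota> x)) / d i)"
      by (subst minus_divide_left) (rule arg_cong[where f = "\<lambda>z. z / d i"], simp)
    ultimately show ?thesis
      unfolding \<psi>_def D_def by (cases b) auto
  qed
  have "sign_functions \<psi> (\<lambda>i. 4 / d i)"
  proof
    show "\<bar>\<psi> i x\<bar> \<le> 1" for i x
      by (auto simp: \<psi>_def)
    show "\<bar>\<psi> i x - \<psi> i y\<bar> \<le> 4 / d i * dist x y" for i x y
      using D_Lip[of i x y] D_Lip[of i y x] by (auto simp: \<psi>_def dist_commute)
    fix b :: "nat \<Rightarrow> real" and n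
    assume b: "\<And>i. b i = 1 \<or> b i = -1"
    obtain c where c: "c \<in> mspace m" "\<And>i. i < n \<Longrightarrow> c \<in> C i (b i = 1)"
      using pat[of n "\<lambda>i. b i = 1"] by blast
    \<comment> \<open>A single radius that serves all \<open>n\<close> levels; the inserted 1 covers
      \<open>n = 0\<close>.\<close>
    define e where "e = Min (insert 1 (d ` {..<n})) / 4"
    have e: "0 < e" "\<And>i. i < n \<Longrightarrow> e \<le> d i / 4"
      using pos by (auto simp: e_def)
    obtain x where x: "mdist m c (\<iota> x) < e"
      using dense[OF c(1) e(1)] by blast
    have "\<psi> i x = b i" if "i < n" for i
      using near[OF c(2)[OF that] c(1), of x] x e(2)[OF that] b[of i] by auto
    then show "\<exists>x. \<forall>i<n. \<psi> i x = b i"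
      by blast
  qed
  then show ?thesis
    by blast
qed

text \<open>A greedy choice gives an infinite \<open>e\<close>-separated sequence \<open>x\<close>.
  Splitting its indices by their \<open>i\<close>-th binary digit gives the pair of level
  \<open>i\<close>, and every finite pattern is the digit pattern of some index.\<close>

lemma sign_functions_if_not_totally_bounded:
  assumes "\<not> K.mtotally_bounded (mspace m)"
  shows "\<exists>(\<psi> :: nat \<Rightarrow> 'a \<Rightarrow> real) Lip. sign_functions \<psi> Lip"
proof -
  obtain e where e: "e > 0" and
    *: "\<And>A. finite A \<Longrightarrow> A \<subseteq> mspace m \<Longrightarrow> \<exists>p\<in>mspace m. \<forall>a\<in>A. e \<le> mdist m a p"
    using assms unfolding K.mtotally_bounded_def by (force simp: subset_iff not_less)
  obtain f where f: "\<And>A. finite A \<Longrightarrow> A \<subseteq> mspace m \<Longrightarrow> f A \<in> mspace m \<and> (\<forall>a\<in>A. e \<le> mdist m a (f A))"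
    using * by metis
  define R where "R = rec_nat {} (\<lambda>_ A. insert (f A) A)"
  have R0: "R 0 = {}" and RS: "R (Suc n) = insert (f (R n)) (R n)" for n
    by (simp_all add: R_def)
  have R: "finite (R n) \<and> R n \<subseteq> mspace m" for n
    by (induction n) (auto simp: R0 RS f)
  define x where "x n = f (R n)" for n
  have x_in: "x n \<in> mspace m" for n
    using f R by (simp add: x_def)
  have R_mono: "R i \<subseteq> R j" if "i \<le> j" for i j
    using that by (rule lift_Suc_mono_le[of R, rotated]) (auto simp: RS)
  have less: "e \<le> mdist m (x i) (x j)" if "i < j" for i j
  proof -
    have "x i \<in> R j"
      using R_mono[of "Suc i" j] that by (auto simp: RS x_def)
    then show ?thesis
      using f[of "R j"] R[of j] by (simp add: x_def)
  qed
  then have sep: "e \<le> mdist m (x i) (x j)" if "i \<noteq> j" for i j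
    using that by (metis K.commute nat_neq_iff)
  let ?C = "\<lambda>i b. x ` {n. (i \<in> set_decode n) = b}"
  show ?thesis
  proof (rule sign_functions_of_separated_pairs[of ?C "\<lambda>_. e"])
    fix b :: "nat \<Rightarrow> bool" and n
    have "i \<in> set_decode (set_encode {i. i < n \<and> b i}) \<longleftrightarrow> b i" if "i < n" for i
      using that by (simp add: set_encode_inverse)
    then show "\<exists>c\<in>mspace m. \<forall>i<n. c \<in> ?C i (b i)"
      using x_in by (intro bexI[of _ "x (set_encode {i. i < n \<and> b i})"]) auto
    fix i p q
    assume "p \<in> ?C i True" "q \<in> ?C i False"
    then obtain k l where "p = x k" "q = x l" "i \<in> set_decode k" "i \<notin> set_decode l"
      by blast
    then show "e \<le> mdist m p q"
      using sep[of k l] by metis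
  qed (use x_in e in auto)
qed

section \<open>Cantor schemes in uncountable compact spaces\<close>

definition separated :: "'b set \<Rightarrow> 'b set \<Rightarrow> bool" where
  "separated A B \<longleftrightarrow> (\<exists>r>0. \<forall>a\<in>A. \<forall>b\<in>B. r \<le> mdist m a b)"

lemma separated_mono: "separated A B \<Longrightarrow> A' \<subseteq> A \<Longrightarrow> B' \<subseteq> B \<Longrightarrow> separated A' B'"
  unfolding separated_def by (meson subsetD)

lemma separated_sym: "separated A B \<Longrightarrow> separated B A"
  unfolding separated_def by (metis K.commute)

lemma separated_UN:
  assumes "finite I" "finite J" "\<And>i j. i \<in> I \<Longrightarrow> j \<in> J \<Longrightarrow> separated (A i) (B j)"
  shows "separated (\<Union>i\<in>I. A i) (\<Union>j\<in>J. B j)"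
proof -
  have "\<forall>i\<in>I. \<forall>j\<in>J. \<exists>r>0. \<forall>a\<in>A i. \<forall>b\<in>B j. r \<le> mdist m a b"
    using assms(3) by (auto simp: separated_def)
  then obtain r where r: "\<And>i j. i \<in> I \<Longrightarrow> j \<in> J \<Longrightarrow> 0 < r i j \<and> (\<forall>a\<in>A i. \<forall>b\<in>B j. r i j \<le> mdist m a b)"
    by metis
  define s where "s = Min (insert 1 ((\<lambda>(i, j). r i j) ` (I \<times> J)))"
  have fin: "finite (insert 1 ((\<lambda>(i, j). r i j) ` (I \<times> J)))"
    using assms by auto
  have "s > 0"
    unfolding s_def using fin r by (subst Min_gr_iff) auto
  moreover have "s \<le> mdist m a b" if "i \<in> I" "j \<in> J" "a \<in> A i" "b \<in> B j" for i j a b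
  proof -
    have "s \<le> r i j"
      unfolding s_def using fin that by (intro Min_le) auto
    then show ?thesis
      using r[OF that(1,2)] that by fastforce
  qed
  ultimately show ?thesis
    unfolding separated_def by blast
qed

text \<open>Finitely many of the balls in which \<open>S\<close> is countable cover
  \<open>T\<close>.\<close>

lemma countable_if_locally_countable:
  assumes K: "compactin K.mtopology T" and thin: "\<And>p. p \<in> T \<Longrightarrow> \<exists>r>0. countable (S \<inter> K.mball p r)"
  shows "countable (S \<inter> T)"
proof -
  have T: "T \<subseteq> mspace m"
    using compactin_subset_topspace[OF K] by simp
  obtain r where r: "\<And>p. p \<in> T \<Longrightarrow> 0 < r p \<and> countable (S \<inter> K.mball p (r p))"
    using thin by metis
  have "\<And>U. U \<in> (\<lambda>p. K.mball p (r p)) ` T \<Longrightarrow> openin K.mtopology U"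
    by auto
  moreover have "T \<subseteq> \<Union> ((\<lambda>p. K.mball p (r p)) ` T)"
    using T r by (auto intro!: K.centre_in_mball_iff[THEN iffD2])
  ultimately obtain \<F> where \<F>: "finite \<F>" "\<F> \<subseteq> (\<lambda>p. K.mball p (r p)) ` T" "T \<subseteq> \<Union>\<F>"
    using K unfolding compactin_def by meson
  have "countable (\<Union>U\<in>\<F>. S \<inter> U)"
    using \<F>(2) r by (intro countable_UN countable_finite[OF \<F>(1)]) auto
  moreover have "S \<inter> T \<subseteq> (\<Union>U\<in>\<F>. S \<inter> U)"
    using \<F>(3) by auto
  ultimately show ?thesis
    by (rule countable_subset[rotated])
qed

text \<open>\<open>S\<close> has two distinct condensation points, and balls of one third of their
  distance around them cut out the two parts. With a single condensation point \<open>p\<close>, the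
  part of \<open>S\<close> outside each ball around \<open>p\<close> would be countable, and these
  parts exhaust \<open>S\<close> except for \<open>p\<close>.\<close>

lemma uncountable_split:
  assumes K: "compact_space K.mtopology" and S: "S \<subseteq> mspace m" "uncountable S"
  shows "\<exists>S0 S1. S0 \<subseteq> S \<and> S1 \<subseteq> S \<and> uncountable S0 \<and> uncountable S1 \<and> separated S0 S1"
proof -
  let ?thin = "\<lambda>p. \<exists>r>0. countable (S \<inter> K.mball p r)"
  have compact_closed: "compactin K.mtopology T" if "closedin K.mtopology T" for T
    using closedin_compact_space[OF K that] .
  have comp: "compactin K.mtopology (mspace m)"
    using K by (simp add: compact_space_def)
  obtain p where p: "p \<in> mspace m" "\<not> ?thin p"
    using countable_if_locally_countable[OF comp, of S] S by (metis inf.absorb1)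
  have "\<exists>q\<in>mspace m. \<not> ?thin q \<and> q \<noteq> p"
  proof (rule ccontr)
    assume "\<not> (\<exists>q\<in>mspace m. \<not> ?thin q \<and> q \<noteq> p)"
    then have thin: "?thin q" if "q \<in> mspace m" "q \<noteq> p" for q
      using that by blast
    have "countable (S \<inter> (mspace m - K.mball p (1 / real (Suc n))))" for n
    proof (rule countable_if_locally_countable)
      show "compactin K.mtopology (mspace m - K.mball p (1 / real (Suc n)))"
        using closedin_diff[OF closedin_topspace K.openin_mball, of p "1 / real (Suc n)"]
        by (intro compact_closed) simp
      fix q assume "q \<in> mspace m - K.mball p (1 / real (Suc n))"
      then show "?thin q"
        using p(1) by (intro thin) auto
    qed
    then have "countable (insert p (\<Union>n. S \<inter> (mspace m - K.mball p (1 / real (Suc n)))))"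
      by (intro countable_insert countable_UN) auto
    moreover have "S \<subseteq> insert p (\<Union>n. S \<inter> (mspace m - K.mball p (1 / real (Suc n))))"
    proof
      fix s assume s: "s \<in> S"
      show "s \<in> insert p (\<Union>n. S \<inter> (mspace m - K.mball p (1 / real (Suc n))))"
      proof (cases "s = p")
        case False
        then have "0 < mdist m p s"
          using s S p by auto
        then obtain n where "1 / real (Suc n) < mdist m p s"
          using nat_approx_posE by blast
        then show ?thesis
          using s S by (auto intro!: exI[of _ n])
      qed auto
    qed
    ultimately show False
      using S(2) countable_subset by blast
  qed
  then obtain q where q: "q \<in> mspace m" "\<not> ?thin q" "q \<noteq> p"
    by blast
  define r where "r = mdist m p q / 3"
  have r: "r > 0"
    using p q by (simp add: r_def)
  have "separated (S \<inter> K.mball p r) (S \<inter> K.mball q r)"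
    unfolding separated_def
  proof (intro exI[of _ r] conjI r ballI)
    fix a b assume a: "a \<in> S \<inter> K.mball p r" and b: "b \<in> S \<inter> K.mball q r"
    have "mdist m p q \<le> mdist m p a + mdist m a q"
      using a p q by (intro K.triangle) auto
    moreover have "mdist m a q \<le> mdist m a b + mdist m b q"
      using a b q by (intro K.triangle) auto
    ultimately show "r \<le> mdist m a b"
      using a b K.commute[of b q] by (auto simp: r_def)
  qed
  then show ?thesis
    using p(2) q(2) r by (intro exI[of _ "S \<inter> K.mball p r"] exI[of _ "S \<inter> K.mball q r"]) auto
qed

text \<open>Repeated splitting gives uncountable sets \<open>D v\<close> indexed by binary words,
  the newest letter first, with distinct words of equal length giving separated sets.
  \<open>C i b\<close> joins the sets of the finitely many words of length \<open>i + 1\<close>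
  whose newest letter is \<open>b\<close>.\<close>

lemma sign_functions_if_uncountable:
  assumes K: "compact_space K.mtopology" and unc: "uncountable (mspace m)"
  shows "\<exists>(\<psi> :: nat \<Rightarrow> 'a \<Rightarrow> real) Lip. sign_functions \<psi> Lip"
proof -
  let ?big = "\<lambda>S. S \<subseteq> mspace m \<and> uncountable S"
  have "\<forall>S. \<exists>s. ?big S \<longrightarrow> (\<forall>b. s b \<subseteq> S \<and> uncountable (s b)) \<and> separated (s True) (s False)"
  proof
    fix S
    show "\<exists>s. ?big S \<longrightarrow> (\<forall>b. s b \<subseteq> S \<and> uncountable (s b)) \<and> separated (s True) (s False)"
    proof (cases "?big S")
      case True
      then have "\<exists>S0 S1. S0 \<subseteq> S \<and> S1 \<subseteq> S \<and> uncountable S0 \<and> uncountable S1 \<and> separated S0 S1"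
        by (intro uncountable_split K) auto
      then obtain S0 S1 where S: "S0 \<subseteq> S" "S1 \<subseteq> S" "uncountable S0" "uncountable S1" "separated S0 S1"
        by (elim exE conjE)
      show ?thesis
        by (rule exI[of _ "\<lambda>b. if b then S0 else S1"]) (simp add: S)
    qed fast
  qed
  then obtain s where s: "\<And>S b. ?big S \<Longrightarrow> s S b \<subseteq> S \<and> uncountable (s S b)"
    "\<And>S. ?big S \<Longrightarrow> separated (s S True) (s S False)"
    by metis
  define D where "D = rec_list (mspace m) (\<lambda>b _ S. s S b)"
  have D0: "D [] = mspace m" and DS: "D (b # v) = s (D v) b" for b v
    by (simp_all add: D_def)
  have big: "?big (D v)" for v
    by (induction v) (use unc s(1) in \<open>auto simp: D0 DS\<close>)
  have D_app: "D (u @ v) \<subseteq> D v" for u v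
    by (induction u) (use s(1)[OF big] in \<open>auto simp: DS\<close>)
  have sepD: "separated (D v) (D w)" if "length v = length w" "v \<noteq> w" for v w
    using that
  proof (induction v w rule: list_induct2)
    case (Cons b v c w)
    show ?case
    proof (cases "v = w")
      case True
      then show ?thesis
        using Cons.prems s(2)[OF big, of v] separated_sym by (cases b; cases c) (auto simp: DS)
    next
      case False
      then show ?thesis
        using Cons.IH s(1)[OF big] by (auto simp: DS intro: separated_mono)
    qed
  qed auto
  let ?I = "\<lambda>i b. {v :: bool list. length v = Suc i \<and> hd v = b}"
  define C where "C i b = (\<Union>v\<in>?I i b. D v)" for i b
  have fin: "finite (?I i b)" for i b
    by (rule finite_subset[OF _ finite_lists_length_eq[of UNIV "Suc i"]]) auto
  have "separated (C i True) (C i False)" for i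
    unfolding C_def by (intro separated_UN fin sepD) auto
  then obtain d where d: "\<And>i. 0 < d i" "\<And>i p q. p \<in> C i True \<Longrightarrow> q \<in> C i False \<Longrightarrow> d i \<le> mdist m p q"
    unfolding separated_def by metis
  show ?thesis
  proof (rule sign_functions_of_separated_pairs[of C d])
    show "C i b \<subseteq> mspace m" for i b
      using big by (auto simp: C_def)
    fix b :: "nat \<Rightarrow> bool" and n
    \<comment> \<open>Reversal puts the newest letter \<open>b (k - 1)\<close> at the head, so every
      \<open>v (Suc i)\<close> with \<open>i < n\<close> is a suffix of \<open>v n\<close> and its
      set contains \<open>D (v n)\<close>.\<close>
    define v where "v k = rev (map b [0..<k])" for k
    have "D (v n) \<noteq> {}"
      using big[of "v n"] by auto
    then obtain c where c: "c \<in> D (v n)"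
      by blast
    have "c \<in> C i (b i)" if "i < n" for i
    proof -
      have "v n = rev (map b [Suc i..<n]) @ v (Suc i)"
        using upt_add_eq_append[of 0 "Suc i" "n - Suc i"] that by (simp add: v_def flip: rev_append map_append)
      then have "c \<in> D (v (Suc i))"
        using c D_app by auto
      then show ?thesis
        by (auto simp: C_def v_def intro!: exI[of _ "b i # rev (map b [0..<i])"])
    qed
    then show "\<exists>c\<in>mspace m. \<forall>i<n. c \<in> C i (b i)"
      using c big[of "v n"] by blast
  qed (use d in auto)
qed

lemma sign_functions_exist:
  assumes "\<not> (compact_space (mtopology_of m) \<and> countable (mspace m))"
  shows "\<exists>(\<psi> :: nat \<Rightarrow> 'a \<Rightarrow> real) Lip. sign_functions \<psi> Lip"
  using assms sign_functions_if_not_totally_bounded sign_functions_if_uncountable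
    K.compact_space_eq_mcomplete_mtotally_bounded mcomplete
  by (auto simp: mtopology_eq)

end

section \<open>Ranking the points of a scattered space\<close>

text \<open>Encodes a rank without ordinals: for a chain of sets, ranks are compared by inclusion of
  lower parts, and the points in the lower part of \<open>x\<close> rank strictly below
  \<open>x\<close>.\<close>

definition lower_part :: "'x set set \<Rightarrow> 'x \<Rightarrow> 'x set" where
  "lower_part \<C> x = \<Union> {U \<in> \<C>. x \<notin> U}"

lemma lower_part_mono: "\<C> \<subseteq> \<D> \<Longrightarrow> lower_part \<C> x \<subseteq> lower_part \<D> x"
  unfolding lower_part_def by blast

lemma not_in_lower_part: "x \<notin> lower_part \<C> x"
  unfolding lower_part_def by blast

text \<open>Some member \<open>U\<close> of the chain contains \<open>y\<close> but not
  \<open>x\<close>. Every member avoiding \<open>y\<close> is then contained in \<open>U\<close>,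
  which itself belongs to the lower part of \<open>x\<close>.\<close>

lemma lower_part_total:
  assumes chain: "\<And>U V. U \<in> \<C> \<Longrightarrow> V \<in> \<C> \<Longrightarrow> U \<subseteq> V \<or> V \<subseteq> U"
    and not: "\<not> lower_part \<C> x \<subseteq> lower_part \<C> y"
  shows "lower_part \<C> y \<subseteq> lower_part \<C> x" "y \<in> lower_part \<C> x"
proof -
  obtain U where U: "U \<in> \<C>" "x \<notin> U" "y \<in> U"
    using not unfolding lower_part_def by blast
  then show "y \<in> lower_part \<C> x"
    unfolding lower_part_def by blast
  have "W \<subseteq> U" if "W \<in> \<C>" "y \<notin> W" for W
    using chain[OF U(1) that(1)] U that by blast
  then show "lower_part \<C> y \<subseteq> lower_part \<C> x"
    using U unfolding lower_part_def by blast
qed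

lemma lower_part_max_exists:
  assumes chain: "\<And>U V. U \<in> \<C> \<Longrightarrow> V \<in> \<C> \<Longrightarrow> U \<subseteq> V \<or> V \<subseteq> U"
    and J: "finite J" "J \<noteq> {}"
  shows "\<exists>j\<in>J. \<forall>i\<in>J. lower_part \<C> (c i) \<subseteq> lower_part \<C> (c j)"
  using J
proof (induction rule: finite_ne_induct)
  case (insert i J)
  then obtain j where j: "j \<in> J" "\<forall>i\<in>J. lower_part \<C> (c i) \<subseteq> lower_part \<C> (c j)"
    by blast
  show ?case
  proof (cases "lower_part \<C> (c i) \<subseteq> lower_part \<C> (c j)")
    case True
    then show ?thesis
      using j by auto
  next
    case False
    then have "lower_part \<C> (c j) \<subseteq> lower_part \<C> (c i)"
      using lower_part_total(1)[OF chain] by blast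
    then show ?thesis
      using j by auto
  qed
qed auto

text \<open>A substitute for the Cantor-Bendixson hierarchy: \<open>x\<close> has higher rank than \<open>y\<close> if its lower part is
  larger, and every point is isolated in the complement of its lower part.\<close>

lemma scattered_open_chain:
  assumes scattered: "\<And>D. closedin X D \<Longrightarrow> D \<noteq> {} \<Longrightarrow> \<exists>e\<in>D. \<exists>U. openin X U \<and> U \<inter> D = {e}"
  obtains \<C> where "\<And>U. U \<in> \<C> \<Longrightarrow> openin X U" "\<And>U V. U \<in> \<C> \<Longrightarrow> V \<in> \<C> \<Longrightarrow> U \<subseteq> V \<or> V \<subseteq> U"
    "\<And>x. x \<in> topspace X \<Longrightarrow> openin X (insert x (lower_part \<C> x))"
proof -
  \<comment> \<open>Zorn's lemma is applied to open chains isolating the points they already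
    cover.\<close>
  define A where "A = {\<C>. (\<forall>U\<in>\<C>. openin X U) \<and> (\<forall>U\<in>\<C>. \<forall>V\<in>\<C>. U \<subseteq> V \<or> V \<subseteq> U)
     \<and> (\<forall>x\<in>\<Union>\<C>. openin X (insert x (lower_part \<C> x)))}"
  \<comment> \<open>Enlarging the chain only adds an open set to the lower part, so isolation
    survives.\<close>
  have grow: "openin X (insert x (lower_part \<D> x))"
    if "\<C> \<subseteq> \<D>" "openin X (insert x (lower_part \<C> x))" "\<And>U. U \<in> \<D> \<Longrightarrow> openin X U" for \<C> \<D> x
  proof -
    have "openin X (lower_part \<D> x)"
      unfolding lower_part_def using that(3) by blast
    then have "openin X (insert x (lower_part \<C> x) \<union> lower_part \<D> x)"
      using that(2) by (rule openin_Un[rotated])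
    moreover have "insert x (lower_part \<C> x) \<union> lower_part \<D> x = insert x (lower_part \<D> x)"
      using lower_part_mono[OF that(1)] by blast
    ultimately show ?thesis
      by simp
  qed
  have "\<exists>M\<in>A. \<forall>Y\<in>A. M \<subseteq> Y \<longrightarrow> Y = M"
  proof (rule subset_Zorn_nonempty)
    show "A \<noteq> {}"
      unfolding A_def by blast
    fix Z assume Z: "Z \<noteq> {}" "subset.chain A Z"
    then have ZA: "Z \<subseteq> A" and Zc: "\<And>a b. a \<in> Z \<Longrightarrow> b \<in> Z \<Longrightarrow> a \<subseteq> b \<or> b \<subseteq> a"
      by (auto simp: subset_chain_def)
    have op: "openin X U" if "U \<in> \<Union>Z" for U
      using that ZA by (auto simp: A_def)
    have "U \<subseteq> V \<or> V \<subseteq> U" if UV: "U \<in> \<Union>Z" "V \<in> \<Union>Z" for U V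
    proof -
      obtain a b where ab: "a \<in> Z" "b \<in> Z" "U \<in> a" "V \<in> b"
        using UV by blast
      then obtain d where "d \<in> Z" "U \<in> d" "V \<in> d"
        using Zc[OF ab(1,2)] by blast
      then show ?thesis
        using ZA by (auto simp: A_def)
    qed
    moreover have "openin X (insert x (lower_part (\<Union>Z) x))" if x: "x \<in> \<Union>(\<Union>Z)" for x
    proof -
      obtain a where a: "a \<in> Z" "x \<in> \<Union>a"
        using x by blast
      then have "openin X (insert x (lower_part a x))"
        using ZA by (auto simp: A_def)
      then show ?thesis
        using a(1) op by (intro grow[of a "\<Union>Z"]) auto
    qed
    ultimately show "\<Union>Z \<in> A"
      using op unfolding A_def by blast
  qed
  then obtain \<C> where \<C>: "\<C> \<in> A" and max: "\<And>\<D>. \<D> \<in> A \<Longrightarrow> \<C> \<subseteq> \<D> \<Longrightarrow> \<D> = \<C>"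
    by blast
  have op: "openin X U" if "U \<in> \<C>" for U
    using \<C> that by (auto simp: A_def)
  have chain: "U \<subseteq> V \<or> V \<subseteq> U" if "U \<in> \<C>" "V \<in> \<C>" for U V
    using \<C> that by (auto simp: A_def)
  have low: "openin X (insert x (lower_part \<C> x))" if "x \<in> \<Union>\<C>" for x
    using \<C> that by (auto simp: A_def)
  have "\<Union>\<C> = topspace X"
  proof (rule ccontr)
    assume ne: "\<Union>\<C> \<noteq> topspace X"
    have opU: "openin X (\<Union>\<C>)"
      using op by blast
    then have sub: "\<Union>\<C> \<subseteq> topspace X"
      by (rule openin_subset)
    then obtain e U where e: "e \<in> topspace X - \<Union>\<C>" "openin X U" "U \<inter> (topspace X - \<Union>\<C>) = {e}"
      using scattered[of "topspace X - \<Union>\<C>"] ne opU by blast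
    \<comment> \<open>If a maximal chain missed some point, the complement of its union would have
      an isolated point \<open>e\<close>, and adding \<open>e\<close> to the union would give a
      longer admissible chain in which the lower part of \<open>e\<close> is the old union.\<close>
    have new: "insert e (\<Union>\<C>) = \<Union>\<C> \<union> U"
      using e openin_subset[OF e(2)] by blast
    have opN: "openin X (insert e (\<Union>\<C>))"
      unfolding new using opU e(2) by (rule openin_Un)
    let ?D = "insert (insert e (\<Union>\<C>)) \<C>"
    have opD: "openin X V" if "V \<in> ?D" for V
      using that op opN by blast
    have "openin X (insert x (lower_part ?D x))" if x: "x \<in> \<Union>?D" for x
    proof (cases "x = e")
      case True
      have "lower_part ?D e = \<Union>\<C>"
        using e(1) unfolding lower_part_def by blast
      then show ?thesis
        using opN True by simp
    next
      case False
      then have "x \<in> \<Union>\<C>"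
        using x by blast
      then show ?thesis
        using low opD by (intro grow[of \<C> ?D]) auto
    qed
    moreover have "V \<subseteq> W \<or> W \<subseteq> V" if "V \<in> ?D" "W \<in> ?D" for V W
      using that chain by blast
    ultimately have "?D \<in> A"
      using opD unfolding A_def by blast
    then have "?D = \<C>"
      by (rule max) blast
    then show False
      using e(1) by blast
  qed
  then show ?thesis
    using that[of \<C>] op chain low by blast
qed

section \<open>Isolated points and stable maximisers on the completion\<close>

context metric_compl
begin

text \<open>A nonempty closed set without isolated points is perfect, and perfect sets in a complete
  metric space have at least the cardinality of the reals.\<close>

lemma countable_closed_isolated_point:
  assumes cnt: "countable (mspace m)" and D: "closedin K.mtopology D" "D \<noteq> {}"
  shows "\<exists>e\<in>D. \<exists>U. openin K.mtopology U \<and> U \<inter> D = {e}"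
proof (rule ccontr)
  assume no: "\<not> ?thesis"
  have DK: "D \<subseteq> mspace m"
    using closedin_subset[OF D(1)] by simp
  have "K.mtopology derived_set_of D = D"
  proof
    show "K.mtopology derived_set_of D \<subseteq> D"
      using D(1) by (simp add: closedin_contains_derived_set)
    show "D \<subseteq> K.mtopology derived_set_of D"
    proof
      fix x assume x: "x \<in> D"
      have "\<exists>y. y \<noteq> x \<and> y \<in> D \<and> y \<in> T" if "x \<in> T" "openin K.mtopology T" for T
      proof (rule ccontr)
        assume "\<not> ?thesis"
        then have "T \<inter> D = {x}"
          using x that by blast
        then show False
          using no x that by blast
      qed
      then show "x \<in> K.mtopology derived_set_of D"
        using x DK by (auto simp: in_derived_set_of)
    qed
  qed
  then have "(UNIV :: real set) \<lesssim> D"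
    using K.lepoll_perfect_set[OF mcomplete] D(2) by blast
  then have "countable (UNIV :: real set)"
    using cnt DK by (meson countable_lepoll countable_subset)
  then show False
    using uncountable_UNIV_real by blast
qed

lemma Lipschitz_attains_sup:
  assumes Lip: "\<And>p q. p \<in> mspace m \<Longrightarrow> q \<in> mspace m \<Longrightarrow> \<bar>\<nu> p - \<nu> q\<bar> \<le> mdist m p q"
    and D: "compactin K.mtopology D" "D \<noteq> {}"
  shows "\<exists>p\<in>D. \<forall>q\<in>D. \<nu> q \<le> (\<nu> p :: real)"
proof -
  have "Lipschitz_continuous_map m euclidean_metric \<nu>"
    unfolding Lipschitz_continuous_map_def by (auto intro!: exI[of _ 1] simp: dist_real_def Lip)
  then have "continuous_map K.mtopology euclideanreal \<nu>"
    using Lipschitz_continuous_imp_continuous_map by (fastforce simp: mtopology_eq)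
  then have "compact (\<nu> ` D)"
    using image_compactin[OF D(1)] by fastforce
  then show ?thesis
    using compact_attains_sup[of "\<nu> ` D"] D(2) by auto
qed

lemma closedin_superlevel:
  assumes Lip: "\<And>p q. p \<in> mspace m \<Longrightarrow> q \<in> mspace m \<Longrightarrow> \<bar>\<nu> p - \<nu> q\<bar> \<le> mdist m p q"
  shows "closedin K.mtopology {p \<in> mspace m. r \<le> (\<nu> p :: real)}"
  unfolding K.closedin_metric
proof (intro conjI allI impI)
  fix x assume x: "x \<in> mspace m - {p \<in> mspace m. r \<le> \<nu> p}"
  have "y \<notin> {p \<in> mspace m. r \<le> \<nu> p}" if "y \<in> K.mball x (r - \<nu> x)" for y
    using Lip[of x y] that x by auto
  then show "\<exists>e>0. disjnt {p \<in> mspace m. r \<le> \<nu> p} (K.mball x e)"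
    using x by (intro exI[of _ "r - \<nu> x"]) (auto simp: disjnt_def)
qed auto

text \<open>Provides the target of the algorithm: a maximiser \<open>x\<close> such that every
  near-maximiser of at least its rank is an exact maximiser. This is what makes bounded regret
  possible even when suboptimal points come arbitrarily close to the optimum.\<close>

lemma stable_maximiser:
  assumes K: "compact_space K.mtopology"
    and Lip: "\<And>p q. p \<in> mspace m \<Longrightarrow> q \<in> mspace m \<Longrightarrow> \<bar>\<nu> p - \<nu> q\<bar> \<le> mdist m p q"
    and op: "\<And>U. U \<in> \<C> \<Longrightarrow> openin K.mtopology U"
    and chain: "\<And>U V. U \<in> \<C> \<Longrightarrow> V \<in> \<C> \<Longrightarrow> U \<subseteq> V \<or> V \<subseteq> U"
    and low: "\<And>x. x \<in> mspace m \<Longrightarrow> openin K.mtopology (insert x (lower_part \<C> x))"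
  obtains x \<gamma> where "x \<in> mspace m" "0 < \<gamma>" "\<And>p. p \<in> mspace m \<Longrightarrow> \<nu> p \<le> (\<nu> x :: real)"
    "\<And>p. p \<in> mspace m \<Longrightarrow> \<nu> x - \<gamma> < \<nu> p \<Longrightarrow> lower_part \<C> x \<subseteq> lower_part \<C> p \<Longrightarrow> \<nu> p = \<nu> x"
proof -
  let ?V = "lower_part \<C>"
  have comp: "compactin K.mtopology (mspace m)"
    using K by (simp add: compact_space_def)
  obtain p0 where p0: "p0 \<in> mspace m" "\<And>q. q \<in> mspace m \<Longrightarrow> \<nu> q \<le> \<nu> p0"
    using Lipschitz_attains_sup[OF Lip comp] \<iota>_in by blast
  define M where "M = {p \<in> mspace m. \<nu> p0 \<le> \<nu> p}"
  have Mc: "compactin K.mtopology M"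
    unfolding M_def using closedin_superlevel[OF Lip] by (intro closedin_compact_space[OF K]) auto
  have Meq: "\<nu> p = \<nu> p0" if "p \<in> M" for p
    using that p0 by (auto simp: M_def intro: antisym)
  have opV: "openin K.mtopology (?V x)" for x
    unfolding lower_part_def using op by blast
  have "\<exists>x\<in>M. \<forall>y\<in>M. ?V y \<subseteq> ?V x"
  proof (rule ccontr)
    assume no: "\<not> ?thesis"
    \<comment> \<open>Without a maximiser of top rank, the open lower parts of the maximisers cover
      the compact set \<open>M\<close>. The largest member of a finite subcover would be all of the
      cover, yet it misses its own point \<open>z\<close>.\<close>
    have "\<exists>z\<in>M. y \<in> ?V z" if "y \<in> M" for y
      using no that lower_part_total(2)[OF chain] by blast
    then have "M \<subseteq> \<Union> (?V ` M)"
      by blast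
    moreover have "\<forall>U\<in>?V ` M. openin K.mtopology U"
      using opV by blast
    ultimately obtain \<F> where \<F>: "finite \<F>" "\<F> \<subseteq> ?V ` M" "M \<subseteq> \<Union>\<F>"
      using Mc unfolding compactin_def by meson
    obtain Z where Z: "Z \<subseteq> M" "finite Z" "\<F> = ?V ` Z"
      using \<F>(1,2) finite_subset_image by metis
    have "p0 \<in> M"
      using p0 by (simp add: M_def)
    then have "Z \<noteq> {}"
      using \<F> Z by blast
    then obtain z where "z \<in> Z" "\<forall>i\<in>Z. ?V i \<subseteq> ?V z"
      using lower_part_max_exists[OF chain Z(2), where c = "\<lambda>x. x"] by blast
    then show False
      using \<F>(3) Z not_in_lower_part[of z \<C>] by blast
  qed
  then obtain x where x: "x \<in> M" "\<And>y. y \<in> M \<Longrightarrow> ?V y \<subseteq> ?V x"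
    by blast
  have xK: "x \<in> mspace m"
    using x by (simp add: M_def)
  \<comment> \<open>\<open>G\<close> is an open neighbourhood of \<open>M\<close>, so compactness of
    its complement yields the gap. A point of \<open>G\<close> of at least the rank of
    \<open>x\<close> lies in none of the lower parts, hence is one of the maximisers
    \<open>y\<close>.\<close>
  define G where "G = (\<Union>y\<in>{y \<in> M. ?V y = ?V x}. insert y (?V y))"
  have opG: "openin K.mtopology G"
    unfolding G_def using low by (intro openin_Union ballI) (force simp: M_def simp del: insert_subset)
  have MG: "M \<subseteq> G"
  proof
    fix y assume y: "y \<in> M"
    show "y \<in> G"
    proof (cases "?V y = ?V x")
      case True
      then show ?thesis
        using y unfolding G_def by blast
    next
      case False
      then have "y \<in> ?V x"
        using x(2)[OF y] lower_part_total(2)[of \<C> x y, OF chain] by blast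
      then show ?thesis
        using x(1) unfolding G_def by blast
    qed
  qed
  let ?B = "mspace m - G"
  have Bc: "compactin K.mtopology ?B"
    using closedin_diff[OF closedin_topspace opG] by (intro closedin_compact_space[OF K]) simp
  have "\<exists>\<gamma>>0. \<forall>p\<in>?B. \<nu> p \<le> \<nu> x - \<gamma>"
  proof (cases "?B = {}")
    case True
    then show ?thesis
      by (intro exI[of _ 1]) auto
  next
    case False
    then obtain b where b: "b \<in> ?B" "\<And>q. q \<in> ?B \<Longrightarrow> \<nu> q \<le> \<nu> b"
      using Lipschitz_attains_sup[OF Lip Bc] by blast
    have "b \<notin> M"
      using b MG by blast
    then have "\<nu> b < \<nu> x"
      using b Meq[OF x(1)] by (auto simp: M_def)
    then show ?thesis
      using b(2) by (intro exI[of _ "\<nu> x - \<nu> b"]) auto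
  qed
  then obtain \<gamma> where \<gamma>: "\<gamma> > 0" "\<And>p. p \<in> ?B \<Longrightarrow> \<nu> p \<le> \<nu> x - \<gamma>"
    by blast
  show ?thesis
  proof (rule that[OF xK \<gamma>(1)])
    show "\<nu> p \<le> \<nu> x" if "p \<in> mspace m" for p
      using p0(2)[OF that] Meq[OF x(1)] by simp
    fix p assume p: "p \<in> mspace m" "\<nu> x - \<gamma> < \<nu> p" "?V x \<subseteq> ?V p"
    have "p \<in> G"
      using \<gamma>(2)[of p] p by (meson DiffI not_le)
    then obtain y where y: "y \<in> M" "?V y = ?V x" "p \<in> insert y (?V y)"
      unfolding G_def by blast
    then have "p = y"
      using p(3) not_in_lower_part[of p \<C>] by blast
    then show "\<nu> p = \<nu> x"
      using Meq y(1) x(1) by simp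
  qed
qed

end

section \<open>Upper bound\<close>

lemma prod_encode_less:
  assumes "j < n" "b < n" "2 * n\<^sup>2 \<le> t"
  shows "prod_encode (j, b) < t"
proof -
  obtain k where n: "n = Suc k"
    using assms(1) by (cases n) auto
  have jb: "j \<le> k" "j + b \<le> 2 * k"
    using assms n by auto
  have "2 * prod_encode (j, b) \<le> (j + b) * Suc (j + b) + 2 * j"
    by (simp add: prod_encode_def triangle_def)
  also have "\<dots> \<le> (2 * k) * Suc (2 * k) + 2 * k"
    using jb by (intro add_mono mult_mono) auto
  also have "\<dots> < 2 * (2 * n\<^sup>2)"
    by (simp add: n power2_eq_square algebra_simps)
  finally show ?thesis
    using assms(3) by linarith
qed

text \<open>The largest \<open>n\<close> with \<open>2 * n\<^sup>2 \<le> t\<close>. By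
  \<open>prod_encode_less\<close>, the first \<open>n\<close> samples for each of the first
  \<open>n\<close> points are all taken before round \<open>t\<close>.\<close>

definition budget :: "nat \<Rightarrow> nat" where
  "budget t = floor_sqrt (t div 2)"

lemma budget_bounds: "2 * (budget t)\<^sup>2 \<le> t" "t < 2 * (budget t + 1)\<^sup>2"
proof -
  have "(budget t)\<^sup>2 \<le> t div 2"
    by (simp add: budget_def)
  then show "2 * (budget t)\<^sup>2 \<le> t"
    by linarith
  have "t div 2 < (budget t + 1)\<^sup>2"
    unfolding budget_def using Suc_floor_sqrt_power2_gt[of "t div 2"] by simp
  then show "t < 2 * (budget t + 1)\<^sup>2"
    by linarith
qed

lemma filterlim_budget: "filterlim budget at_top at_top"
  unfolding filterlim_at_top
proof
  fix Z
  have "Z \<le> budget t" if "t \<ge> 2 * Z\<^sup>2" for t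
  proof (rule ccontr)
    assume "\<not> Z \<le> budget t"
    then have "(budget t + 1)\<^sup>2 \<le> Z\<^sup>2"
      by (intro power_mono) auto
    then show False
      using budget_bounds(2)[of t] that by linarith
  qed
  then show "\<forall>\<^sub>F t in sequentially. Z \<le> budget t"
    using eventually_ge_at_top by (rule eventually_mono[rotated])
qed

text \<open>The exponential in \<open>sqrt (budget t)\<close> beats every power of
  \<open>budget t\<close>. The fourth power suffices, because \<open>budget t\<close> grows like the
  square root of \<open>t\<close> and so leaves the summable order \<open>1 / t ^ 2\<close>.\<close>

lemma summable_budget_tail: "summable (\<lambda>t. real (budget t) * (2 * exp (- 2 * sqrt (real (budget t)))))"
proof (rule summable_comparison_test_ev)
  have "\<forall>\<^sub>F n :: nat in at_top. real n * (2 * exp (- 2 * sqrt (real n))) \<le> 1 / (real n + 1) ^ 4"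
    by real_asymp
  then have "\<forall>\<^sub>F t in sequentially. real (budget t) * (2 * exp (- 2 * sqrt (real (budget t)))) \<le> 1 / (real (budget t) + 1) ^ 4"
    using filterlim_budget by (rule eventually_compose_filterlim)
  then show "\<forall>\<^sub>F t in sequentially. norm (real (budget t) * (2 * exp (- 2 * sqrt (real (budget t))))) \<le> 4 * (1 / real t ^ 2)"
    using eventually_gt_at_top[of 0]
  proof eventually_elim
    case (elim t)
    have "real t < real (2 * (budget t + 1)\<^sup>2)"
      using budget_bounds(2) of_nat_less_iff by blast
    then have "real t ^ 2 \<le> (2 * (real (budget t) + 1)\<^sup>2) ^ 2"
      by (intro power_mono) (auto simp: add.commute)
    then have "real t ^ 2 \<le> 4 * (real (budget t) + 1) ^ 4"
      by (simp add: power_mult_distrib flip: power_mult)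
    then have "1 / (real (budget t) + 1) ^ 4 \<le> 4 * (1 / real t ^ 2)"
      using elim(2) by (simp add: field_simps)
    then show ?case
      using elim by simp
  qed
  show "summable (\<lambda>t. 4 * (1 / real t ^ 2))"
    using inverse_power_summable[of 2, where ?'a = real] by (intro summable_mult) (simp add: field_simps)
qed

lemma length_history: "length (history \<sigma> \<omega> F t) = t"
  by (induction t) auto

lemma nth_history:
  "r < t \<Longrightarrow> history \<sigma> \<omega> F t ! r = map (F r) (round_points (\<sigma> \<omega> (history \<sigma> \<omega> F r)) (F r))"
  by (induction t) (auto simp: nth_append length_history less_Suc_eq)

lemma distr_sequence_component:
  "prob_space P \<Longrightarrow> distr (\<Pi>\<^sub>M _\<in>(UNIV :: nat set). P) P (\<lambda>F. F r) = P"
  using distr_PiM_component[of UNIV "\<lambda>_. P" r] by simp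

lemma indep_vars_PiM_components:
  assumes "prob_space P"
  shows "prob_space.indep_vars (\<Pi>\<^sub>M _\<in>(UNIV :: nat set). P) (\<lambda>_. P) (\<lambda>r F. F r) UNIV"
proof -
  interpret prob_space "\<Pi>\<^sub>M _\<in>(UNIV :: nat set). P"
    by (intro prob_space_PiM assms)
  show ?thesis
    by (subst indep_vars_iff_distr_eq_PiM) (auto simp: distr_sequence_component assms restrict_UNIV distr_id2)
qed

text \<open>The points \<open>x r\<close> are fixed in advance, so the payoffs
  \<open>F r (x r)\<close> of different rounds are independent and take values in [0, 1].\<close>

lemma experts_instance_Hoeffding:
  fixes I :: "nat set" and x :: "nat \<Rightarrow> 'a::metric_space"
  assumes P: "experts_instance P" and I: "finite I" "I \<noteq> {}" and \<epsilon>: "\<epsilon> \<ge> 0"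
  defines "S \<equiv> \<Pi>\<^sub>M _\<in>(UNIV :: nat set). P"
  shows "measure S {F \<in> space S. \<epsilon> \<le> \<bar>(\<Sum>r\<in>I. F r (x r)) - (\<Sum>r\<in>I. mean_payoff P (x r))\<bar>}
      \<le> 2 * exp (- 2 * \<epsilon>\<^sup>2 / real (card I))"
proof -
  have prob: "prob_space P" and sets: "sets P = sets payoff_space"
    using P by (auto simp: experts_instance_def)
  interpret S: prob_space S
    unfolding S_def by (intro prob_space_PiM prob)
  have eval: "(\<lambda>f. f y) \<in> borel_measurable P" for y :: 'a
    by (simp add: measurable_cong_sets[OF sets refl])
  have space: "F r y \<in> {0..1}" if "F \<in> space S" for F r and y :: 'a
    using that sets_eq_imp_space_eq[OF sets]
    by (auto simp: S_def space_PiM PiE_def Pi_iff space_payoff_space)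
  have mean: "S.expectation (\<lambda>F. F r (x r)) = mean_payoff P (x r)" for r
  proof -
    have "mean_payoff P (x r) = (\<integral>f. f (x r) \<partial>distr S P (\<lambda>F. F r))"
      unfolding S_def mean_payoff_def by (simp add: distr_sequence_component prob)
    also have "\<dots> = S.expectation (\<lambda>F. F r (x r))"
      using eval by (intro integral_distr) (auto simp: S_def)
    finally show ?thesis ..
  qed
  have indep: "S.indep_vars (\<lambda>_. borel) (\<lambda>r F. F r (x r)) I"
  proof (rule S.indep_vars_subset)
    show "S.indep_vars (\<lambda>_. borel) (\<lambda>r F. F r (x r)) UNIV"
      using S.indep_vars_compose2[OF indep_vars_PiM_components[OF prob, folded S_def], of "\<lambda>r f. f (x r)" "\<lambda>_. borel"] eval
      by simp
  qed auto
  interpret Hoeffding_ineq S I "\<lambda>r F. F r (x r)" "\<lambda>_. 0" "\<lambda>_. 1" "\<Sum>r\<in>I. S.expectation (\<lambda>F. F r (x r))"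
    by unfold_locales (use I indep space in \<open>auto intro!: AE_I2\<close>)
  have "S.prob {F \<in> space S. \<bar>(\<Sum>r\<in>I. F r (x r)) - (\<Sum>r\<in>I. S.expectation (\<lambda>F. F r (x r)))\<bar> \<ge> \<epsilon>}
      \<le> 2 * exp (- 2 * \<epsilon>\<^sup>2 / (\<Sum>i\<in>I. (1 - 0)\<^sup>2))"
    by (rule Hoeffding_ineq_abs_ge) (use \<epsilon> I in \<open>auto simp: card_gt_0_iff\<close>)
  then show ?thesis
    by (simp add: mean)
qed

section \<open>Extension of the mean to the completion\<close>

context metric_compl
begin

text \<open>The McShane formula for extending a 1-Lipschitz function.\<close>

definition mean_extension :: "('a \<Rightarrow> real) measure \<Rightarrow> 'b \<Rightarrow> real" where
  "mean_extension P p = (INF x. mean_payoff P x + mdist m p (\<iota> x))"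

lemma mean_extension_close:
  assumes P: "experts_instance P" and p: "p \<in> mspace m"
  shows "\<bar>mean_extension P p - mean_payoff P x\<bar> \<le> mdist m p (\<iota> x)"
proof -
  have "mean_extension P p \<le> mean_payoff P x + mdist m p (\<iota> x)"
    unfolding mean_extension_def
    by (intro cINF_lower bdd_belowI2[where m = 0] add_nonneg_nonneg mean_payoff_bounded[OF P]) auto
  moreover have "mean_payoff P x - mdist m p (\<iota> x) \<le> mean_extension P p"
    unfolding mean_extension_def
  proof (rule cINF_greatest)
    fix y
    have "\<bar>mean_payoff P x - mean_payoff P y\<bar> \<le> dist x y"
      using P by (simp add: experts_instance_def)
    also have "\<dots> \<le> mdist m p (\<iota> x) + mdist m p (\<iota> y)"
      using K.triangle[of "\<iota> x" p "\<iota> y"] p K.commute[of p "\<iota> x"] by (simp add: mdist_\<iota>)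
    finally show "mean_payoff P x - mdist m p (\<iota> x) \<le> mean_payoff P y + mdist m p (\<iota> y)"
      by linarith
  qed simp
  ultimately show ?thesis
    by linarith
qed

lemma mean_extension_\<iota>: "experts_instance P \<Longrightarrow> mean_extension P (\<iota> x) = mean_payoff P x"
  using mean_extension_close[of P "\<iota> x" x] by simp

lemma mean_extension_Lipschitz:
  assumes P: "experts_instance P" and p: "p \<in> mspace m" and q: "q \<in> mspace m"
  shows "\<bar>mean_extension P p - mean_extension P q\<bar> \<le> mdist m p q"
proof (rule field_le_epsilon)
  fix e :: real assume e: "e > 0"
  obtain x where x: "mdist m p (\<iota> x) < e / 2"
    using dense[OF p, of "e / 2"] e by auto
  have "mdist m q (\<iota> x) \<le> mdist m p q + mdist m p (\<iota> x)"
    using K.triangle[of q p "\<iota> x"] p q K.commute[of p q] by simp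
  then show "\<bar>mean_extension P p - mean_extension P q\<bar> \<le> mdist m p q + e"
    using mean_extension_close[OF P p, of x] mean_extension_close[OF P q, of x] x by linarith
qed

end

section \<open>The algorithm with double feedback\<close>

locale double_feedback_algorithm = metric_compl m \<iota>
  for m :: "'b metric" and \<iota> :: "'a::metric_space \<Rightarrow> 'b" +
  fixes \<C> :: "'b set set" and c :: "nat \<Rightarrow> 'b" and a :: "nat \<Rightarrow> nat \<Rightarrow> 'a"
  assumes compact: "compact_space K.mtopology"
    and \<C>_open: "\<And>U. U \<in> \<C> \<Longrightarrow> openin K.mtopology U"
    and \<C>_chain: "\<And>U V. U \<in> \<C> \<Longrightarrow> V \<in> \<C> \<Longrightarrow> U \<subseteq> V \<or> V \<subseteq> U"
    and \<C>_isolates: "\<And>x. x \<in> mspace m \<Longrightarrow> openin K.mtopology (insert x (lower_part \<C> x))"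
    and range_c: "range c = mspace m"
    and approx: "\<And>j k. mdist m (c j) (\<iota> (a j k)) < (1/2) ^ k"
begin

lemma c_in [simp]: "c j \<in> mspace m"
  using range_c by blast

text \<open>Round \<open>prod_encode (j, b)\<close> is reserved for the \<open>b\<close>-th sample
  concerning \<open>c j\<close>. As \<open>c j\<close> need not belong to \<open>X\<close>, the
  sample is taken at the approximation \<open>a j b\<close>.\<close>

definition estimate :: "nat \<Rightarrow> nat \<Rightarrow> (nat \<Rightarrow> 'a \<Rightarrow> real) \<Rightarrow> real" where
  "estimate n j F = (\<Sum>b<n. F (prod_encode (j, b)) (a j b)) / real n"

text \<open>With this choice \<open>n * (width n)\<^sup>2 = sqrt n\<close>, so the width tends to 0
  while the failure probabilities remain summable.\<close>

definition width :: "nat \<Rightarrow> real" where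
  "width n = 1 / sqrt (sqrt (real n))"

text \<open>The term \<open>2 / real n\<close> covers the bias from sampling at \<open>a j b\<close>
  instead of \<open>c j\<close>: the errors \<open>(1/2) ^ b\<close> sum to at most 2.\<close>

definition tolerance :: "nat \<Rightarrow> real" where
  "tolerance n = width n + 2 / real n"

definition candidates :: "nat \<Rightarrow> (nat \<Rightarrow> real) \<Rightarrow> nat set" where
  "candidates n e = {j. j < n \<and> (\<forall>i<n. e i - 2 * tolerance n \<le> e j)}"

text \<open>Candidates are compared by rank rather than by estimate, because the estimates cannot
  tell an optimum from nearby suboptimal points.\<close>

definition leader :: "nat set \<Rightarrow> nat" where
  "leader J = (SOME j. j \<in> J \<and> (\<forall>i\<in>J. lower_part \<C> (c i) \<subseteq> lower_part \<C> (c j)))"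

definition query :: "nat \<Rightarrow> 'a" where
  "query r = (case prod_decode r of (j, b) \<Rightarrow> a j b)"

text \<open>Entry 1 of each recorded round is the value at the extra point, entry 0 being the payoff
  of the played point. The played point approximates the leader within \<open>(1/2) ^ t\<close> in
  round \<open>t\<close>, so these errors are summable as well.\<close>

definition strategy :: "'a strategy" where
  "strategy = (\<lambda>_ h. let n = budget (length h) in
     (a (leader (candidates n (\<lambda>j. (\<Sum>b<n. h ! prod_encode (j, b) ! 1) / real n))) (length h),
      Query (query (length h)) (\<lambda>_. Stop)))"

lemma pick_strategy:
  "pick strategy \<omega> F t = a (leader (candidates (budget t) (\<lambda>j. estimate (budget t) j F))) t"
proof -
  have "history strategy \<omega> F t ! prod_encode (j, b) ! 1 = F (prod_encode (j, b)) (a j b)"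
    if "j < budget t" "b < budget t" for j b
    using nth_history[OF prod_encode_less[OF that budget_bounds(1)], of strategy \<omega> F]
    by (simp add: round_points_def strategy_def Let_def length_history query_def)
  then have "candidates (budget t) (\<lambda>j. (\<Sum>b<budget t. history strategy \<omega> F t ! prod_encode (j, b) ! 1) / real (budget t))
     = candidates (budget t) (\<lambda>j. estimate (budget t) j F)"
    unfolding candidates_def estimate_def by (intro Collect_cong conj_cong refl all_cong) simp
  then show ?thesis
    by (simp add: pick_def strategy_def Let_def length_history)
qed

lemma estimate_measurable [measurable]:
  "estimate n j \<in> borel_measurable (\<Pi>\<^sub>M _\<in>(UNIV :: nat set). payoff_space)"
proof -
  have "(\<lambda>F. F r x) \<in> borel_measurable (\<Pi>\<^sub>M _\<in>(UNIV :: nat set). payoff_space)" for r and x :: 'a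
    by (rule measurable_compose[of "\<lambda>F. F r" _ payoff_space "\<lambda>f. f x"]) auto
  then show ?thesis
    unfolding estimate_def by measurable
qed

text \<open>The set of candidates takes finitely many values, so any function of it, in particular
  the choice made by \<open>leader\<close>, is measurable.\<close>

lemma candidates_measurable:
  "(\<lambda>F. candidates n (\<lambda>j. estimate n j F))
     \<in> (\<Pi>\<^sub>M _\<in>(UNIV :: nat set). payoff_space) \<rightarrow>\<^sub>M count_space (Pow {..<n})"
    (is "?f \<in> ?S \<rightarrow>\<^sub>M _")
proof (subst measurable_count_space_eq2)
  show "finite (Pow {..<n})"
    by simp
  have "?f -` {J} \<inter> space ?S \<in> sets ?S" if J: "J \<in> Pow {..<n}" for J
  proof -
    have "?f -` {J} \<inter> space ?S = {F \<in> space ?S. \<forall>j\<in>{..<n}. (j \<in> J) =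
        (\<forall>i\<in>{..<n}. estimate n i F - 2 * tolerance n \<le> estimate n j F)}"
    proof -
      have "({j. j < n \<and> Q j} = J) \<longleftrightarrow> (\<forall>j\<in>{..<n}. (j \<in> J) = Q j)" for Q
        using J by blast
      then show ?thesis
        by (intro set_eqI) (simp add: candidates_def Ball_def conj_commute[of _ "_ \<in> space _"])
    qed
    also have "\<dots> \<in> sets ?S"
    proof (rule sets.sets_Collect_finite_All)
      fix j
      have "{F \<in> space ?S. \<forall>i\<in>{..<n}. estimate n i F - 2 * tolerance n \<le> estimate n j F} \<in> sets ?S" (is ?Q)
        by (intro sets.sets_Collect_finite_All borel_measurable_le borel_measurable_diff
            borel_measurable_const estimate_measurable) auto
      then show "{F \<in> space ?S. (j \<in> J) = (\<forall>i\<in>{..<n}. estimate n i F - 2 * tolerance n \<le> estimate n j F)} \<in> sets ?S"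
        using sets.sets_Collect_neg[OF \<open>?Q\<close>] by (cases "j \<in> J") simp_all
    qed simp
    finally show ?thesis .
  qed
  then show "?f \<in> space ?S \<rightarrow> Pow {..<n} \<and> (\<forall>J\<in>Pow {..<n}. ?f -` {J} \<inter> space ?S \<in> sets ?S)"
    by (auto simp: candidates_def)
qed

lemma strategy_double_feedback: "strategy \<in> double_feedback"
proof -
  have "(\<lambda>F. a (leader (candidates (budget s) (\<lambda>j. estimate (budget s) j F))) s)
      \<in> (\<Pi>\<^sub>M _\<in>(UNIV :: nat set). payoff_space) \<rightarrow>\<^sub>M borel" for s
    by (rule measurable_compose[OF candidates_measurable]) simp
  from measurable_compose[OF measurable_snd this]
  have pick: "(\<lambda>x. pick strategy (fst x) (snd x) s)
      \<in> borel \<Otimes>\<^sub>M (\<Pi>\<^sub>M _\<in>(UNIV :: nat set). payoff_space) \<rightarrow>\<^sub>M borel" for s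
    by (simp add: pick_strategy)
  have eval: "evaluated_point strategy \<omega> F s i = (if i = 1 then query s else pick strategy \<omega> F s)" for \<omega> F s i
    by (auto simp: evaluated_point_def round_points_def Let_def strategy_def pick_def length_history
        less_Suc_eq numeral_2_eq_2)
  have "(\<lambda>(\<omega>, F). evaluated_point strategy \<omega> F s i)
      \<in> borel \<Otimes>\<^sub>M (\<Pi>\<^sub>M _\<in>(UNIV :: nat set). payoff_space) \<rightarrow>\<^sub>M borel" for s i
    using pick[of s] by (cases "i = 1") (auto simp: eval split_beta')
  then show ?thesis
    unfolding double_feedback_def full_feedback_def by (auto simp: strategy_def Let_def)
qed

definition bad :: "('a \<Rightarrow> real) measure \<Rightarrow> nat \<Rightarrow> (nat \<Rightarrow> 'a \<Rightarrow> real) set" where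
  "bad P n = {F. \<exists>j<n. width n \<le> \<bar>estimate n j F - (\<Sum>b<n. mean_payoff P (a j b)) / real n\<bar>}"

text \<open>A union bound over the \<open>n\<close> estimated points; for each of them Hoeffding's
  inequality with deviation \<open>n * width n\<close> has exponent
  \<open>- 2 * sqrt n\<close>.\<close>

lemma measure_bad:
  assumes P: "experts_instance P"
  defines "S \<equiv> \<Pi>\<^sub>M _\<in>(UNIV :: nat set). P"
  shows "space S \<inter> bad P n \<in> sets S"
    "measure S (space S \<inter> bad P n) \<le> real n * (2 * exp (- 2 * sqrt (real n)))"
proof -
  have prob: "prob_space P" and sets: "sets P = sets payoff_space"
    using P by (auto simp: experts_instance_def)
  interpret S: prob_space S
    unfolding S_def by (intro prob_space_PiM prob)
  have sets_S: "sets S = sets (\<Pi>\<^sub>M _\<in>(UNIV :: nat set). payoff_space)"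
    unfolding S_def by (intro sets_PiM_cong refl sets)
  have [measurable]: "estimate n j \<in> borel_measurable S" for j
    using estimate_measurable by (simp add: measurable_cong_sets[OF sets_S refl])
  let ?A = "\<lambda>j. {F \<in> space S. width n \<le> \<bar>estimate n j F - (\<Sum>b<n. mean_payoff P (a j b)) / real n\<bar>}"
  have eq: "space S \<inter> bad P n = (\<Union>j<n. ?A j)"
    by (auto simp: bad_def)
  have A: "?A j \<in> S.events" for j
    by measurable
  show "space S \<inter> bad P n \<in> sets S"
    unfolding eq using A by (intro sets.finite_UN) auto
  have "measure S (?A j) \<le> 2 * exp (- 2 * sqrt (real n))" if "j < n" for j
  proof -
    have n: "0 < real n"
      using that by simp
    let ?I = "(\<lambda>b. prod_encode (j, b)) ` {..<n}"
    have inj: "inj_on (\<lambda>b. prod_encode (j, b)) {..<n}"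
      by (auto intro!: inj_onI)
    have "?A j = {F \<in> space S. real n * width n \<le> \<bar>(\<Sum>r\<in>?I. F r (query r)) - (\<Sum>r\<in>?I. mean_payoff P (query r))\<bar>}"
    proof (intro Collect_cong conj_cong refl)
      fix F
      have "\<bar>estimate n j F - (\<Sum>b<n. mean_payoff P (a j b)) / real n\<bar>
          = \<bar>(\<Sum>r\<in>?I. F r (query r)) - (\<Sum>r\<in>?I. mean_payoff P (query r))\<bar> / real n"
        using n by (simp add: sum.reindex[OF inj] estimate_def query_def flip: diff_divide_distrib)
      then show "width n \<le> \<bar>estimate n j F - (\<Sum>b<n. mean_payoff P (a j b)) / real n\<bar>
         \<longleftrightarrow> real n * width n \<le> \<bar>(\<Sum>r\<in>?I. F r (query r)) - (\<Sum>r\<in>?I. mean_payoff P (query r))\<bar>"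
        using n by (simp add: pos_le_divide_eq mult.commute)
    qed
    also have "measure S \<dots> \<le> 2 * exp (- 2 * (real n * width n)\<^sup>2 / real (card ?I))"
      unfolding S_def by (rule experts_instance_Hoeffding[OF P]) (use n in \<open>auto simp: width_def\<close>)
    also have "- 2 * (real n * width n)\<^sup>2 / real (card ?I) = - 2 * sqrt (real n)"
    proof -
      have "(width n)\<^sup>2 = 1 / sqrt (real n)"
        by (simp add: width_def power_divide)
      then have "(real n * width n)\<^sup>2 / real n = sqrt (real n)"
        using n by (simp add: power_mult_distrib power2_eq_square[of "real n"] real_div_sqrt)
      then show ?thesis
        by (simp add: card_image[OF inj])
    qed
    finally show ?thesis .
  qed
  then have "(\<Sum>j<n. measure S (?A j)) \<le> (\<Sum>j<n. 2 * exp (- 2 * sqrt (real n)))"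
    by (intro sum_mono) auto
  moreover have "measure S (space S \<inter> bad P n) \<le> (\<Sum>j<n. measure S (?A j))"
    unfolding eq using A by (intro S.finite_measure_subadditive_finite) auto
  ultimately show "measure S (space S \<inter> bad P n) \<le> real n * (2 * exp (- 2 * sqrt (real n)))"
    by simp
qed

lemma good_estimate:
  assumes P: "experts_instance P" and F: "F \<notin> bad P n" and j: "j < n"
  shows "\<bar>estimate n j F - mean_extension P (c j)\<bar> \<le> tolerance n"
proof -
  have n: "0 < real n"
    using j by simp
  have "\<bar>(\<Sum>b<n. mean_payoff P (a j b)) / real n - mean_extension P (c j)\<bar>
      = \<bar>\<Sum>b<n. mean_payoff P (a j b) - mean_extension P (c j)\<bar> / real n"
    using n by (simp add: sum_subtractf field_simps)
  also have "\<dots> \<le> (\<Sum>b<n. (1/2) ^ b) / real n"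
  proof (intro divide_right_mono order_trans[OF sum_abs] sum_mono)
    fix b
    show "\<bar>mean_payoff P (a j b) - mean_extension P (c j)\<bar> \<le> (1/2) ^ b"
      using mean_extension_close[OF P c_in, of j "a j b"] approx[of j b] by linarith
  qed simp
  also have "(\<Sum>b<n. (1/2) ^ b) \<le> (2 :: real)"
    by (simp add: geometric_sum)
  finally have "\<bar>(\<Sum>b<n. mean_payoff P (a j b)) / real n - mean_extension P (c j)\<bar> \<le> 2 / real n"
    using n by (simp add: divide_right_mono)
  moreover have "\<bar>estimate n j F - (\<Sum>b<n. mean_payoff P (a j b)) / real n\<bar> < width n"
    using F j by (auto simp: bad_def not_le)
  ultimately show ?thesis
    unfolding tolerance_def by linarith
qed

text \<open>The slack \<open>2 * tolerance n\<close> admits the maximiser \<open>c j\<close> as a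
  candidate, so the leader has at least its rank. The slack and two estimation errors put the leader
  within \<open>4 * tolerance n\<close> of the maximum, and stability makes it exactly
  optimal.\<close>

lemma leader_optimal:
  assumes e: "\<And>j. j < n \<Longrightarrow> \<bar>e j - \<nu> (c j)\<bar> \<le> tolerance n"
    and j: "j < n" and max: "\<And>i. \<nu> (c i) \<le> \<nu> (c j)"
    and stable: "\<And>i. \<nu> (c j) - \<gamma> < \<nu> (c i) \<Longrightarrow> lower_part \<C> (c j) \<subseteq> lower_part \<C> (c i) \<Longrightarrow> \<nu> (c i) = \<nu> (c j)"
    and \<gamma>: "4 * tolerance n < \<gamma>"
  shows "\<nu> (c (leader (candidates n e))) = \<nu> (c j)"
proof -
  let ?J = "candidates n e" and ?k = "leader (candidates n e)"
  have jJ: "j \<in> ?J"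
    unfolding candidates_def
  proof (intro CollectI conjI allI impI j)
    fix i assume "i < n"
    then show "e i - 2 * tolerance n \<le> e j"
      using e[of i] e[OF j] max[of i] by linarith
  qed
  moreover have "finite ?J"
    by (simp add: candidates_def)
  ultimately have "\<exists>k. k \<in> ?J \<and> (\<forall>i\<in>?J. lower_part \<C> (c i) \<subseteq> lower_part \<C> (c k))"
    using lower_part_max_exists[of \<C> ?J c, OF \<C>_chain] by blast
  then have k: "?k \<in> ?J" "\<And>i. i \<in> ?J \<Longrightarrow> lower_part \<C> (c i) \<subseteq> lower_part \<C> (c ?k)"
    unfolding leader_def by (auto dest!: someI_ex)
  have "e j - 2 * tolerance n \<le> e ?k" "?k < n"
    using k(1) j by (auto simp: candidates_def)
  then have "\<nu> (c j) - \<gamma> < \<nu> (c ?k)"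
    using e[OF j] e[of ?k] \<gamma> by linarith
  then show ?thesis
    using stable k(2)[OF jJ] by blast
qed

lemma tolerance_tendsto: "tolerance \<longlonglongrightarrow> 0"
  unfolding tolerance_def[abs_def] width_def by real_asymp

text \<open>The loss of round \<open>s\<close> is at most the sum of the approximation error
  \<open>(1/2) ^ s\<close>, a loss 1 in the finitely many rounds before \<open>T\<close>, and a loss
  1 on the bad event. Each contribution has a finite total expectation.\<close>

lemma regret_bounded:
  assumes P: "experts_instance P" and W: "prob_space W" "sets W = sets borel"
  shows "\<exists>C. \<forall>t\<ge>1. regret W strategy P t \<le> C * 1"
proof -
  let ?\<mu> = "mean_payoff P" and ?\<nu> = "mean_extension P"
  define S where "S = (\<Pi>\<^sub>M _\<in>(UNIV :: nat set). P)"
  have prob: "prob_space P" and sets: "sets P = sets payoff_space"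
    using P by (auto simp: experts_instance_def)
  interpret S: prob_space S
    unfolding S_def by (intro prob_space_PiM prob)
  interpret W: prob_space W
    by (rule W)
  interpret WS: pair_prob_space W S ..
  have sets_S: "sets S = sets (\<Pi>\<^sub>M _\<in>(UNIV :: nat set). payoff_space)"
    unfolding S_def by (intro sets_PiM_cong refl sets)
  have sets_WS: "sets (W \<Otimes>\<^sub>M S) = sets (borel \<Otimes>\<^sub>M (\<Pi>\<^sub>M _\<in>(UNIV :: nat set). payoff_space))"
    by (intro sets_pair_measure_cong W sets_S)
  obtain x \<gamma> where x: "x \<in> mspace m" "0 < \<gamma>" "\<And>p. p \<in> mspace m \<Longrightarrow> ?\<nu> p \<le> ?\<nu> x"
    and stable: "\<And>p. p \<in> mspace m \<Longrightarrow> ?\<nu> x - \<gamma> < ?\<nu> p \<Longrightarrow> lower_part \<C> x \<subseteq> lower_part \<C> p \<Longrightarrow> ?\<nu> p = ?\<nu> x"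
    using stable_maximiser[OF compact mean_extension_Lipschitz[OF P] \<C>_open \<C>_chain \<C>_isolates] by blast
  obtain j where j: "x = c j"
    using x(1) range_c by blast
  define M where "M = (SUP x. ?\<mu> x)"
  have M1: "M \<le> 1"
    unfolding M_def by (intro cSUP_least mean_payoff_bounded[OF P]) auto
  have M\<nu>: "M \<le> ?\<nu> (c j)"
    unfolding M_def
  proof (rule cSUP_least)
    fix y
    show "?\<mu> y \<le> ?\<nu> (c j)"
      using x(3)[of "\<iota> y"] mean_extension_\<iota>[OF P, of y] j by simp
  qed simp
  \<comment> \<open>From round \<open>T\<close> on, the tolerance is below the gap of the instance
    and the stable maximiser \<open>c j\<close> is among the estimated points. The constant depends
    on the instance through \<open>T\<close>, which the algorithm does not know.\<close>
  have "\<forall>\<^sub>F n in sequentially. 4 * tolerance n < \<gamma> \<and> j < n"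
    using order_tendstoD(2)[OF tendsto_mult_left[OF tolerance_tendsto, of 4], of \<gamma>] x(2)
    by (intro eventually_conj eventually_gt_at_top) simp
  from eventually_compose_filterlim[OF this filterlim_budget]
  obtain T where T: "\<And>s. s \<ge> T \<Longrightarrow> 4 * tolerance (budget s) < \<gamma> \<and> j < budget s"
    by (auto simp: eventually_sequentially)
  let ?bad = "\<lambda>s. bad P (budget s)"
  have loss: "M - ?\<mu> (pick strategy \<omega> F s) \<le> (1/2) ^ s + (if s < T then 1 else 0) + indicator (?bad s) F" for \<omega> F s
  proof (cases "s < T \<or> F \<in> ?bad s")
    case True
    have "M - ?\<mu> (pick strategy \<omega> F s) \<le> 1"
      using M1 mean_payoff_bounded(1)[OF P, of "pick strategy \<omega> F s"] by linarith
    moreover have "1 \<le> (if s < T then 1 else 0) + (indicator (?bad s) F :: real)"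
      using True by (auto simp: indicator_def)
    moreover have "0 \<le> (1/2 :: real) ^ s"
      by simp
    ultimately show ?thesis
      by linarith
  next
    case False
    let ?k = "leader (candidates (budget s) (\<lambda>j. estimate (budget s) j F))"
    have "?\<nu> (c ?k) = ?\<nu> (c j)"
      by (rule leader_optimal[where \<gamma> = \<gamma>])
         (use False good_estimate[OF P] T[of s] x(3) j stable[OF c_in] in auto)
    then show ?thesis
      using False M\<nu> mean_extension_close[OF P c_in, of ?k "a ?k s"] approx[of ?k s]
      by (simp add: pick_strategy)
  qed
  have strat: "strategy \<in> full_feedback"
    using strategy_double_feedback by (simp add: double_feedback_def)
  have int_pick: "integrable (W \<Otimes>\<^sub>M S) (\<lambda>(\<omega>, F). ?\<mu> (pick strategy \<omega> F s))" for s
  proof (rule WS.integrable_const_bound[where B = 1])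
    have "(\<lambda>x. ?\<mu> (case x of (\<omega>, F) \<Rightarrow> pick strategy \<omega> F s)) \<in> borel_measurable (W \<Otimes>\<^sub>M S)"
      using measurable_compose[OF pick_measurable[OF strat] borel_measurable_continuous_onI[OF continuous_mean_payoff[OF P]]]
      by (simp add: measurable_cong_sets[OF sets_WS refl])
    then show "(\<lambda>(\<omega>, F). ?\<mu> (pick strategy \<omega> F s)) \<in> borel_measurable (W \<Otimes>\<^sub>M S)"
      by (simp add: split_beta')
  qed (use mean_payoff_bounded[OF P] in auto)
  define fail where "fail s = real (budget s) * (2 * exp (- 2 * sqrt (real (budget s))))" for s
  have round: "M - (\<integral>(\<omega>, F). ?\<mu> (pick strategy \<omega> F s) \<partial>(W \<Otimes>\<^sub>M S)) \<le> (1/2) ^ s + (if s < T then 1 else 0) + fail s" for s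
  proof -
    let ?B = "space W \<times> (space S \<inter> ?bad s)"
    have B: "?B \<in> sets (W \<Otimes>\<^sub>M S)"
      using measure_bad(1)[OF P, folded S_def] by auto
    have "M - (\<integral>(\<omega>, F). ?\<mu> (pick strategy \<omega> F s) \<partial>(W \<Otimes>\<^sub>M S)) = (\<integral>x. M - (case x of (\<omega>, F) \<Rightarrow> ?\<mu> (pick strategy \<omega> F s)) \<partial>(W \<Otimes>\<^sub>M S))"
      using int_pick[of s] by (simp add: WS.prob_space)
    also have "\<dots> \<le> (\<integral>x. (1/2) ^ s + (if s < T then 1 else 0) + indicator ?B x \<partial>(W \<Otimes>\<^sub>M S))"
    proof (rule integral_mono)
      show "integrable (W \<Otimes>\<^sub>M S) (\<lambda>x. (1/2) ^ s + (if s < T then 1 else 0) + indicator ?B x :: real)"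
        using B by (intro Bochner_Integration.integrable_add) (auto simp: WS.emeasure_eq_measure)
      fix x assume "x \<in> space (W \<Otimes>\<^sub>M S)"
      then show "M - (case x of (\<omega>, F) \<Rightarrow> ?\<mu> (pick strategy \<omega> F s)) \<le> (1/2) ^ s + (if s < T then 1 else 0) + indicator ?B x"
        using loss[of "fst x" "snd x" s] by (cases x) (simp add: space_pair_measure indicator_def)
    qed (use int_pick[of s] in auto)
    also have "\<dots> = (1/2) ^ s + (if s < T then 1 else 0) + measure (W \<Otimes>\<^sub>M S) ?B"
      using B by (subst Bochner_Integration.integral_add) (auto simp: WS.prob_space WS.emeasure_eq_measure)
    also have "measure (W \<Otimes>\<^sub>M S) ?B = measure S (space S \<inter> ?bad s)"
      using measure_bad(1)[OF P, folded S_def]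
      by (simp add: measure_def S.emeasure_pair_measure_Times W.emeasure_space_1)
    also have "\<dots> \<le> fail s"
      unfolding fail_def using measure_bad(2)[OF P, folded S_def] .
    finally show ?thesis
      by simp
  qed
  have summ: "summable fail"
    unfolding fail_def by (rule summable_budget_tail)
  have fail0: "0 \<le> fail s" for s
    by (simp add: fail_def)
  have "regret W strategy P t \<le> 2 + real T + suminf fail" for t
  proof -
    have "regret W strategy P t = (\<Sum>s<t. M - (\<integral>(\<omega>, F). ?\<mu> (pick strategy \<omega> F s) \<partial>(W \<Otimes>\<^sub>M S)))"
      unfolding regret_def M_def[symmetric] S_def[symmetric]
      using int_pick by (simp add: split_beta' sum_subtractf)
    also have "\<dots> \<le> (\<Sum>s<t. (1/2) ^ s + (if s < T then 1 else 0) + fail s)"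
      using round by (intro sum_mono) blast
    also have "\<dots> = (\<Sum>s<t. (1/2) ^ s) + (\<Sum>s<t. if s < T then 1 else 0) + (\<Sum>s<t. fail s)"
      by (simp add: sum.distrib)
    also have "\<dots> \<le> 2 + real T + suminf fail"
    proof (intro add_mono)
      show "(\<Sum>s<t. (1/2) ^ s) \<le> (2 :: real)"
        by (simp add: geometric_sum)
      have "(\<Sum>s<t. if s < T then 1 else 0) = real (card ({..<t} \<inter> {s. s < T}))"
        by (simp add: sum.If_cases)
      also have "\<dots> \<le> real (card {..<T})"
        by (intro of_nat_mono card_mono) auto
      finally show "(\<Sum>s<t. if s < T then 1 else 0) \<le> real T"
        by simp
      show "(\<Sum>s<t. fail s) \<le> suminf fail"
        using summ fail0 by (intro sum_le_suminf) auto
    qed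
    finally show ?thesis .
  qed
  then show ?thesis
    by (intro exI[of _ "2 + real T + suminf fail"]) simp
qed

end

lemma (in metric_compl) one_tractable:
  assumes K: "compact_space K.mtopology" and cnt: "countable (mspace m)"
  shows "tractable (double_feedback :: 'a strategy set) (\<lambda>_. 1)"
proof -
  obtain \<C> where \<C>: "\<And>U. U \<in> \<C> \<Longrightarrow> openin K.mtopology U"
    "\<And>U V. U \<in> \<C> \<Longrightarrow> V \<in> \<C> \<Longrightarrow> U \<subseteq> V \<or> V \<subseteq> U"
    "\<And>x. x \<in> topspace K.mtopology \<Longrightarrow> openin K.mtopology (insert x (lower_part \<C> x))"
    using scattered_open_chain[OF countable_closed_isolated_point[OF cnt]] by blast
  define c where "c = from_nat_into (mspace m)"
  have "mspace m \<noteq> {}"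
    using \<iota>_in by blast
  then have c: "range c = mspace m"
    unfolding c_def using cnt by (simp add: range_from_nat_into)
  have "\<exists>x. mdist m (c j) (\<iota> x) < (1/2) ^ k" for j k
    using c by (intro dense) auto
  then obtain a where a: "\<And>j k. mdist m (c j) (\<iota> (a j k)) < (1/2) ^ k"
    by metis
  interpret double_feedback_algorithm m \<iota> \<C> c a
    by unfold_locales (use K \<C> c a in auto)
  \<comment> \<open>The strategy is deterministic, so a point mass can serve as the law of the
    seed.\<close>
  have W: "prob_space (return borel (0 :: real))" "sets (return borel (0 :: real)) = sets borel"
    by (auto intro: prob_space_return)
  then show ?thesis
    unfolding tractable_def using strategy_double_feedback regret_bounded[OF _ W] by blast
qed

theorem theorem6p1:
  fixes m :: "'b metric" and \<iota> :: "'a::metric_space \<Rightarrow> 'b"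
  assumes diam: "\<And>x y :: 'a. dist x y \<le> 1"
    and compl: "metric_completion m \<iota>"
  shows "let one_tractable = tractable (double_feedback :: 'a strategy set) (\<lambda>_. 1);
             sqrt_hard = (\<forall>g :: nat \<Rightarrow> real.
               (\<lambda>t. g t / sqrt (real t)) \<longlonglongrightarrow> 0 \<longrightarrow>
                 \<not> tractable (full_feedback :: 'a strategy set) g)
         in (one_tractable \<or> sqrt_hard) \<and> \<not> (one_tractable \<and> sqrt_hard) \<and>
            (one_tractable \<longleftrightarrow> compact_space (mtopology_of m) \<and> countable (mspace m))"
  proof -
  interpret metric_compl m \<iota>
    by unfold_locales (rule compl)
  let ?cc = "compact_space (mtopology_of m) \<and> countable (mspace m)"
  have easy: "tractable (double_feedback :: 'a strategy set) (\<lambda>_. 1)" if ?cc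
    using that one_tractable by (simp add: mtopology_eq)
  have hard: "\<not> tractable (full_feedback :: 'a strategy set) g"
    if "\<not> ?cc" "(\<lambda>t. g t / sqrt (real t)) \<longlonglongrightarrow> 0" for g
    using sign_functions_exist[OF that(1)] sign_functions.not_tractable[OF _ that(2)] by blast
  have mono: "tractable (double_feedback :: 'a strategy set) g \<Longrightarrow> tractable (full_feedback :: 'a strategy set) g" for g
    unfolding tractable_def double_feedback_def by blast
  \<comment> \<open>The constant 1 is itself of order o(sqrt t). With \<open>mono\<close>,
    1-tractability under double feedback contradicts hardness under full feedback, which gives both
    the exclusion and the converse of the characterisation.\<close>
  have one: "(\<lambda>t. 1 / sqrt (real t)) \<longlonglongrightarrow> 0"
    by real_asymp
  show ?thesis
  proof (cases ?cc)
    case True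
    then have one_tractable: "tractable (double_feedback :: 'a strategy set) (\<lambda>_. 1)"
      by (rule easy)
    have "\<not> (\<forall>g. (\<lambda>t. g t / sqrt (real t)) \<longlonglongrightarrow> 0 \<longrightarrow> \<not> tractable (full_feedback :: 'a strategy set) g)"
      using mono[OF one_tractable] one by (intro notI) (drule spec[of _ "\<lambda>_. 1"], simp)
    then show ?thesis
      unfolding Let_def using one_tractable True by blast
  next
    case False
    then have "\<not> tractable (double_feedback :: 'a strategy set) (\<lambda>_. 1)"
      using hard[of "\<lambda>_. 1"] mono one by blast
    then show ?thesis
      unfolding Let_def using hard False by blast
  qed
qed


end
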